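(* Let $(A,\sigma)$ be a central simple $F$-algebra with involution of orthogonal or symplectic type. Let $F_1=F((x))$ and $F_2=F((x))((y))$ be (iterated) Laurent series fields, let $H$ be the quaternion $F_2$-algebra $(x,y)_{F_2}$, let $\rho$ be any involution of orthogonal or symplectic type on $H$, and let $$(A_1,\sigma_1)=(A,\sigma)\otimes_F\mathrm{Ad}_{\langle\!\langle x\rangle\!\rangle},\qquad (A_2,\sigma_2)=(A,\sigma)\otimes_F(H,\rho).$$ Assume $(A,\sigma)$ is anisotropic. Then $(A_1,\sigma_1)$ and $(A_2,\sigma_2)$ are anisotropic. Moreover, the following conditions are equivalent: (i) $(A,\sigma)$ contains $(Q,\bar{\ })$; (ii) $(A_1,\sigma_1)$ contains $(Q,\bar{\ })$; (iii) $(A_2,\sigma_2)$ contains $(Q,\bar{\ })$.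
   Context: $F$ is a field of characteristic different from $2$; involutions are of the first kind (linear over the center). $Q=(a,b)_F$, with $a,b\in F^\times$, is a quaternion algebra that is assumed not split, and $\bar{\ }$ is its canonical (symplectic) involution. $\langle\!\langle x\rangle\!\rangle$ is the quadratic form $\langle1,-x\rangle$ over $F_1$, and $\mathrm{Ad}_{\langle\!\langle x\rangle\!\rangle}=(M_2(F_1),\mathrm{ad}_{\langle\!\langle x\rangle\!\rangle})$, where $\mathrm{ad}_q$ denotes the involution adjoint to the quadratic form $q$. Thus $(A_i,\sigma_i)$ is a central simple $F_i$-algebra with involution for $i=1,2$. An involution $\sigma$ is isotropic if $\sigma(s)s=0$ for some $s\neq0$, anisotropic otherwise. $(A,\sigma)$ contains $(B,\tau)$ if $A$ contains a $\sigma$-stable subalgebra isomorphic to $B$ such that the restriction of $\sigma$ corresponds to a conjugate of $\tau$. In (ii) and (iii), containing $(Q,\bar{\ })$ means containing $(Q,\bar{\ })\otimes_F F_i$ as an $F_i$-algebra with involution; equivalently, $A_i$ contains elements $\mathbf{i},\mathbf{j}$ with $\mathbf{i}^2=a$, $\mathbf{j}^2=b$, $\mathbf{j}\mathbf{i}=-\mathbf{i}\mathbf{j}$, $\sigma_i(\mathbf{i})=-\mathbf{i}$, $\sigma_i(\mathbf{j})=-\mathbf{j}$. *)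

theory Defs
  imports
    "HOL-Analysis.Finite_Cartesian_Product"
    "HOL-Library.Numeral_Type"
    "HOL-Library.Poly_Mapping"
    "HOL-Computational_Algebra.Group_Closure"
    "HOL-Computational_Algebra.Formal_Laurent_Series"
begin

section \<open>Algebras with involution\<close>

text \<open>The underlying ring of an algebra is a type of class \<open>ring_1\<close> (so algebras are unital and
  nonzero, not necessarily commutative); the record carries the rest of the structure.\<close>

record ('k, 'a) alg_inv =
  scl :: "'k \<Rightarrow> 'a \<Rightarrow> 'a"
  invol :: "'a \<Rightarrow> 'a"

definition algebra_over :: "('k::field \<Rightarrow> 'a::ring_1 \<Rightarrow> 'a) \<Rightarrow> bool" where
  "algebra_over s \<longleftrightarrow> vector_space s \<and>
     (\<forall>c a b. s c (a * b) = s c a * b \<and> s c (a * b) = a * s c b)"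

definition two_sided_ideal :: "'a::ring_1 set \<Rightarrow> bool" where
  "two_sided_ideal I \<longleftrightarrow> 0 \<in> I \<and> (\<forall>x\<in>I. \<forall>y\<in>I. x + y \<in> I) \<and>
     (\<forall>x\<in>I. \<forall>a. a * x \<in> I \<and> x * a \<in> I)"

definition central_simple_algebra :: "('k::field \<Rightarrow> 'a::ring_1 \<Rightarrow> 'a) \<Rightarrow> bool" where
  "central_simple_algebra s \<longleftrightarrow> algebra_over s \<and>
     (\<exists>B. finite B \<and> module.span s B = UNIV) \<and>
     {z. \<forall>a. z * a = a * z} = range (\<lambda>c. s c 1) \<and>
     (\<forall>I::'a set. two_sided_ideal I \<longrightarrow> I = {0} \<or> I = UNIV)"

text \<open>Involutions of the first kind, i.e. linear over the base field. On a central simple algebra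
  over a field of characteristic different from 2, these are exactly the involutions of orthogonal
  or symplectic type.\<close>

definition is_involution :: "('k::field, 'a::ring_1) alg_inv \<Rightarrow> bool" where
  "is_involution A \<longleftrightarrow> Vector_Spaces.linear (scl A) (scl A) (invol A) \<and>
     (\<forall>a b. invol A (a * b) = invol A b * invol A a) \<and> (\<forall>a. invol A (invol A a) = a)"

definition csa_with_involution :: "('k::field, 'a::ring_1) alg_inv \<Rightarrow> bool" where
  "csa_with_involution A \<longleftrightarrow> central_simple_algebra (scl A) \<and> is_involution A"

definition isotropic :: "('k, 'a::ring_1) alg_inv \<Rightarrow> bool" where
  "isotropic A \<longleftrightarrow> (\<exists>s. s \<noteq> 0 \<and> invol A s * s = 0)"

abbreviation anisotropic :: "('k, 'a::ring_1) alg_inv \<Rightarrow> bool" where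
  "anisotropic A \<equiv> \<not> isotropic A"

definition algebra_hom ::
    "('k::field \<Rightarrow> 'a::ring_1 \<Rightarrow> 'a) \<Rightarrow> ('k \<Rightarrow> 'b::ring_1 \<Rightarrow> 'b) \<Rightarrow> ('a \<Rightarrow> 'b) \<Rightarrow> bool" where
  "algebra_hom sA sB \<phi> \<longleftrightarrow> Vector_Spaces.linear sA sB \<phi> \<and>
     (\<forall>a b. \<phi> (a * b) = \<phi> a * \<phi> b) \<and> \<phi> 1 = 1"

definition subalgebra :: "('k::field \<Rightarrow> 'a::ring_1 \<Rightarrow> 'a) \<Rightarrow> 'a set \<Rightarrow> bool" where
  "subalgebra s S \<longleftrightarrow> module.subspace s S \<and> 1 \<in> S \<and> (\<forall>a\<in>S. \<forall>b\<in>S. a * b \<in> S)"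

text \<open>The conjugate of an involution \<open>\<tau>\<close> by a unit \<open>g\<close> (with inverse \<open>h\<close>) is \<open>Int(g) \<circ> \<tau> \<circ> Int(g)\<^sup>-\<^sup>1\<close>,
  where \<open>Int(g)\<close> is the inner automorphism \<open>b \<mapsto> g b h\<close>.\<close>

definition contains_alg_inv ::
    "('k::field, 'a::ring_1) alg_inv \<Rightarrow> ('k, 'b::ring_1) alg_inv \<Rightarrow> bool" where
  "contains_alg_inv A B \<longleftrightarrow>
     (\<exists>S \<phi> g h. subalgebra (scl A) S \<and> invol A ` S \<subseteq> S \<and>
        algebra_hom (scl B) (scl A) \<phi> \<and> bij_betw \<phi> UNIV S \<and>
        g * h = 1 \<and> h * g = 1 \<and>
        (\<forall>b. invol A (\<phi> b) = \<phi> (g * invol B (h * b * g) * h)))"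


section \<open>Tensor products\<close>

text \<open>Let \<open>A\<close> be an \<open>F\<close>-algebra, and \<open>B\<close> an algebra over a field \<open>K\<close> that is itself an extension of \<open>F\<close>
  via \<open>\<iota> : F \<rightarrow> K\<close>. The abelian group \<open>A \<otimes>\<^sub>F B\<close> is the quotient of the free abelian group on \<open>A \<times> B\<close> by
  the subgroup generated by the following relations.\<close>

definition tensor_relations ::
    "('f \<Rightarrow> 'k) \<Rightarrow> ('f \<Rightarrow> 'a::ring_1 \<Rightarrow> 'a) \<Rightarrow> ('k \<Rightarrow> 'b::ring_1 \<Rightarrow> 'b) \<Rightarrow> ('a \<times> 'b \<Rightarrow>\<^sub>0 int) set" where
  "tensor_relations \<iota> sA sB = group_closure
     ({frag_of (a + a', b) - frag_of (a, b) - frag_of (a', b) | a a' b. True} \<union>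
      {frag_of (a, b + b') - frag_of (a, b) - frag_of (a, b') | a b b'. True} \<union>
      {frag_of (sA c a, b) - frag_of (a, sB (\<iota> c) b) | c a b. True})"

text \<open>The additive extension of a map \<open>\<beta>\<close> on \<open>A \<times> B\<close> to the free abelian group on \<open>A \<times> B\<close>.\<close>

definition frag_eval :: "('a \<Rightarrow> 'b \<Rightarrow> 't::ring_1) \<Rightarrow> ('a \<times> 'b \<Rightarrow>\<^sub>0 int) \<Rightarrow> 't" where
  "frag_eval \<beta> f = (\<Sum>p\<in>Poly_Mapping.keys f. of_int (Poly_Mapping.lookup f p) * \<beta> (fst p) (snd p))"

text \<open>\<open>is_tensor_product \<iota> A B T \<beta>\<close>: the \<open>K\<close>-algebra with involution \<open>T\<close>, together with
  \<open>\<beta> a b = a \<otimes> b\<close>, is (a copy of) \<open>A \<otimes>\<^sub>F B\<close>. The first two conditions after \<open>algebra_over\<close> say that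
  \<open>\<beta>\<close> induces an isomorphism from the quotient above onto the additive group of \<open>T\<close>; the others
  prescribe the multiplication, the action of \<open>K\<close> and the involution on the generators \<open>a \<otimes> b\<close>.
  The tensor product is a relation rather than a function because its type would have to depend on
  the scalar multiplications.\<close>

definition is_tensor_product ::
    "('f::field \<Rightarrow> 'k::field) \<Rightarrow> ('f, 'a::ring_1) alg_inv \<Rightarrow> ('k, 'b::ring_1) alg_inv \<Rightarrow>
     ('k, 't::ring_1) alg_inv \<Rightarrow> ('a \<Rightarrow> 'b \<Rightarrow> 't) \<Rightarrow> bool" where
  "is_tensor_product \<iota> A B T \<beta> \<longleftrightarrow>
     algebra_over (scl T) \<and>
     surj (frag_eval \<beta>) \<and>
     {f. frag_eval \<beta> f = 0} = tensor_relations \<iota> (scl A) (scl B) \<and>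
     \<beta> 1 1 = 1 \<and>
     (\<forall>a b a' b'. \<beta> a b * \<beta> a' b' = \<beta> (a * a') (b * b')) \<and>
     (\<forall>c a b. scl T c (\<beta> a b) = \<beta> a (scl B c b)) \<and>
     additive (invol T) \<and>
     (\<forall>a b. invol T (\<beta> a b) = \<beta> (invol A a) (invol B b))"

text \<open>A field as an algebra with involution over itself; \<open>A \<otimes>\<^sub>F K\<close> with \<open>K\<close> in this role is the scalar
  extension of \<open>A\<close> to \<open>K\<close>.\<close>

definition field_alg_inv :: "('k::field, 'k) alg_inv" where
  "field_alg_inv = \<lparr>scl = (*), invol = (\<lambda>c. c)\<rparr>"


section \<open>Matrix algebras and adjoint involutions\<close>

text \<open>A copy of \<open>'k^'n^'n\<close> is needed because the library multiplies vectors componentwise.\<close>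

typedef ('k, 'n) sqmat = "UNIV :: ('k ^ 'n ^ 'n) set"
  morphisms vec_of_sqmat sqmat_of_vec ..

setup_lifting type_definition_sqmat

instantiation sqmat :: (field, finite) ring_1
begin

lift_definition zero_sqmat :: "('a, 'b) sqmat" is 0 .
lift_definition one_sqmat :: "('a, 'b) sqmat" is "mat 1" .
lift_definition plus_sqmat :: "('a, 'b) sqmat \<Rightarrow> ('a, 'b) sqmat \<Rightarrow> ('a, 'b) sqmat" is "(+)" .
lift_definition minus_sqmat :: "('a, 'b) sqmat \<Rightarrow> ('a, 'b) sqmat \<Rightarrow> ('a, 'b) sqmat" is "(-)" .
lift_definition uminus_sqmat :: "('a, 'b) sqmat \<Rightarrow> ('a, 'b) sqmat" is uminus .
lift_definition times_sqmat :: "('a, 'b) sqmat \<Rightarrow> ('a, 'b) sqmat \<Rightarrow> ('a, 'b) sqmat" is "(**)" .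

instance
proof
  fix A B C :: "('a, 'b) sqmat"
  show "A * B * C = A * (B * C)"
    by transfer (simp add: matrix_mul_assoc)
  show "A + B + C = A + (B + C)" "A + B = B + A" "0 + A = A" "- A + A = 0" "A - B = A + - B"
    by (transfer; simp add: algebra_simps)+
  show "1 * A = A" "A * 1 = A"
    by (transfer; simp)+
  show "(A + B) * C = A * C + B * C"
    by transfer (vector matrix_matrix_mult_def sum.distrib[symmetric] field_simps)
  show "A * (B + C) = A * B + A * C"
    by transfer (simp add: matrix_add_ldistrib)
  show "(0::('a, 'b) sqmat) \<noteq> 1"
    by transfer (simp add: mat_def vec_eq_iff)
qed

end

lift_definition sqmat_scl :: "'k::field \<Rightarrow> ('k, 'n::finite) sqmat \<Rightarrow> ('k, 'n) sqmat"
  is "\<lambda>c M. \<chi> i j. c * M $ i $ j" .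

lift_definition sqmat_apply :: "('k::field, 'n::finite) sqmat \<Rightarrow> 'k ^ 'n \<Rightarrow> 'k ^ 'n"
  is "(*v)" .

definition polar_form :: "('k::field ^ 'n \<Rightarrow> 'k) \<Rightarrow> 'k ^ 'n \<Rightarrow> 'k ^ 'n \<Rightarrow> 'k" where
  "polar_form q v w = q (v + w) - q v - q w"

text \<open>Meaningful for quadratic forms \<open>q\<close> with nondegenerate polar form.\<close>

definition adjoint_involution ::
    "('k::field ^ 'n::finite \<Rightarrow> 'k) \<Rightarrow> ('k, 'n) sqmat \<Rightarrow> ('k, 'n) sqmat" where
  "adjoint_involution q M = (THE M'. \<forall>v w.
     polar_form q v (sqmat_apply M w) = polar_form q (sqmat_apply M' v) w)"

definition Ad :: "('k::field ^ 'n::finite \<Rightarrow> 'k) \<Rightarrow> ('k, ('k, 'n) sqmat) alg_inv" where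
  "Ad q = \<lparr>scl = sqmat_scl, invol = adjoint_involution q\<rparr>"

text \<open>The quadratic form \<open>\<langle>1, -x\<rangle>\<close>.\<close>

definition pfister_form :: "'k::field \<Rightarrow> 'k ^ 2 \<Rightarrow> 'k" where
  "pfister_form x v = (v $ 1)\<^sup>2 - x * (v $ 2)\<^sup>2"


section \<open>Quaternion algebras\<close>

definition quat_comb :: "('k::field \<Rightarrow> 'q::ring_1 \<Rightarrow> 'q) \<Rightarrow> 'q \<Rightarrow> 'q \<Rightarrow> 'k \<times> 'k \<times> 'k \<times> 'k \<Rightarrow> 'q" where
  "quat_comb s i j = (\<lambda>(c0, c1, c2, c3). s c0 1 + s c1 i + s c2 j + s c3 (i * j))"

text \<open>The algebra is the quaternion algebra \<open>(a, b)\<close> over \<open>K\<close>, with standard generators \<open>i\<close>, \<open>j\<close>;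
  bijectivity says that \<open>1, i, j, ij\<close> is a basis.\<close>

definition quaternion_algebra ::
    "('k::field \<Rightarrow> 'q::ring_1 \<Rightarrow> 'q) \<Rightarrow> 'k \<Rightarrow> 'k \<Rightarrow> 'q \<Rightarrow> 'q \<Rightarrow> bool" where
  "quaternion_algebra s a b i j \<longleftrightarrow> algebra_over s \<and> a \<noteq> 0 \<and> b \<noteq> 0 \<and>
     i * i = s a 1 \<and> j * j = s b 1 \<and> j * i = - (i * j) \<and> bij (quat_comb s i j)"

definition is_quat_conj :: "('k::field, 'q::ring_1) alg_inv \<Rightarrow> 'q \<Rightarrow> 'q \<Rightarrow> bool" where
  "is_quat_conj Q i j \<longleftrightarrow> (\<forall>c0 c1 c2 c3.
     invol Q (quat_comb (scl Q) i j (c0, c1, c2, c3)) = quat_comb (scl Q) i j (c0, - c1, - c2, - c3))"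

definition split_quaternion :: "('k::field \<Rightarrow> 'q::ring_1 \<Rightarrow> 'q) \<Rightarrow> bool" where
  "split_quaternion s \<longleftrightarrow>
     (\<exists>\<phi> :: 'q \<Rightarrow> ('k, 2) sqmat. algebra_hom s sqmat_scl \<phi> \<and> bij \<phi>)"


section \<open>Iterated Laurent series fields\<close>

text \<open>\<open>F((x))\<close> is \<open>'f fls\<close> and \<open>F((x))((y))\<close> is \<open>'f fls fls\<close>.\<close>

definition emb1 :: "'f::field \<Rightarrow> 'f fls" where
  "emb1 c = fls_const c"

definition emb2 :: "'f::field \<Rightarrow> 'f fls fls" where
  "emb2 c = fls_const (fls_const c)"

definition x1 :: "'f::field fls" where
  "x1 = fls_X"

definition x2 :: "'f::field fls fls" where
  "x2 = fls_const fls_X"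

definition y2 :: "'f::field fls fls" where
  "y2 = fls_X"

end

theory Submission
  imports Defs "HOL-Analysis.Cartesian_Space" "HOL-Library.Product_Lexorder"
begin

text \<open>Let \<open>B\<close> be \<open>M\<^sub>2(F((x)))\<close> or \<open>H\<close>, with its involution \<open>\<rho>\<close>. Its elements (for \<open>M\<^sub>2\<close>,
  the columns of its elements) have leading terms with respect to a valuation that takes values in
  \<open>1/2 \<int>\<close> or \<open>1/2 \<int>\<^sup>2\<close>, and \<open>\<rho>\<close> preserves the leading terms up to nonzero scalars.
  Therefore, on a finite set \<open>S \<subseteq> B\<close>, there are \<open>F\<close>-linear functionals
  \<open>l\<close>, \<open>m\<close> with \<open>l(\<rho>(h) k) = m(h) m(k)\<close> and \<open>m\<close> not identically zero: \<open>m\<close> is the coefficient in the lowest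
  degree \<open>\<gamma>\<close> occurring in \<open>S\<close>, and \<open>l\<close> is essentially the coefficient in degree \<open>2 \<gamma>\<close>. For
  \<open>t = \<Sum> e \<otimes> h\<^sub>e\<close> with \<open>h\<^sub>e \<in> S\<close>, the map \<open>id \<otimes> l\<close> sends \<open>(\<sigma> \<otimes> \<rho>)(t) t\<close> to \<open>\<sigma>(s) s\<close>, where
  \<open>s = \<Sum> m(h\<^sub>e) e \<noteq> 0\<close>, and this is nonzero because \<open>\<sigma>\<close> is anisotropic; so \<open>\<sigma> \<otimes> \<rho>\<close> is anisotropic.
  If \<open>(\<sigma> \<otimes> \<rho>)(t) t\<close> is a constant, it follows that \<open>\<gamma> \<ge> 0\<close>. Hence quaternion generators
  in \<open>A \<otimes> B\<close> lie in \<open>A \<otimes> V\<close> for the valuation ring \<open>V\<close>, and the residue map \<open>V \<rightarrow> F\<close> carries them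
  to quaternion generators in \<open>A\<close>.\<close>

section \<open>Linear functionals on tensor products\<close>

lemma frag_eval_superset:
  assumes "finite P" "Poly_Mapping.keys f \<subseteq> P"
  shows "frag_eval \<beta> f = (\<Sum>p\<in>P. of_int (Poly_Mapping.lookup f p) * \<beta> (fst p) (snd p))"
  unfolding frag_eval_def using assms
  by (intro sum.mono_neutral_left) (auto simp: in_keys_iff)

lemma frag_eval_diff: "frag_eval \<beta> (f - g) = frag_eval \<beta> f - frag_eval \<beta> g"
proof -
  let ?P = "Poly_Mapping.keys f \<union> Poly_Mapping.keys g"
  have "frag_eval \<beta> h = (\<Sum>p\<in>?P. of_int (Poly_Mapping.lookup h p) * \<beta> (fst p) (snd p))"
    if "h \<in> {f, g, f - g}" for h
    using that keys_diff[of f g] by (intro frag_eval_superset) auto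
  then show ?thesis
    by (simp add: lookup_minus left_diff_distrib sum_subtractf)
qed

lemma frag_eval_zero [simp]: "frag_eval \<beta> 0 = 0"
  by (simp add: frag_eval_def)

lemma frag_eval_frag_of [simp]: "frag_eval \<beta> (frag_of p) = \<beta> (fst p) (snd p)"
  by (simp add: frag_eval_def keys_frag_of)

text \<open>Linearity is over \<open>F\<close> only: the functionals to be used pick out
  coefficients of series and are not \<open>K\<close>-linear.\<close>

definition base_linear :: "('f::field \<Rightarrow> 'k) \<Rightarrow> ('k \<Rightarrow> 'b::ring_1 \<Rightarrow> 'b) \<Rightarrow> ('b \<Rightarrow> 'f) \<Rightarrow> bool" where
  "base_linear \<iota> s l \<longleftrightarrow> (\<forall>x y. l (x + y) = l x + l y) \<and> (\<forall>c x. l (s (\<iota> c) x) = c * l x)"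

text \<open>Containment is traded for this condition on two elements, which is easier to carry along
  \<beta> and residue maps than a subalgebra.\<close>

definition quaternion_pair ::
    "('k::field, 'a::ring_1) alg_inv \<Rightarrow> 'k \<Rightarrow> 'k \<Rightarrow> 'a \<Rightarrow> 'a \<Rightarrow> bool" where
  "quaternion_pair A a b I J \<longleftrightarrow> I * I = scl A a 1 \<and> J * J = scl A b 1 \<and> J * I = - (I * J) \<and>
     invol A I = - I \<and> invol A J = - J"

locale tensor_product =
  fixes \<iota> :: "'f::field \<Rightarrow> 'k::field" and A :: "('f, 'a::ring_1) alg_inv"
    and B :: "('k, 'b::ring_1) alg_inv" and T :: "('k, 't::ring_1) alg_inv"
    and \<beta> :: "'a \<Rightarrow> 'b \<Rightarrow> 't"
  assumes tensor: "is_tensor_product \<iota> A B T \<beta>"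
    and algebra_A: "algebra_over (scl A)"
begin

sublocale A: vector_space "scl A"
  using algebra_A by (simp add: algebra_over_def)

sublocale T: vector_space "scl T"
  using tensor by (simp add: is_tensor_product_def algebra_over_def)

lemma scl_mult: "scl A c (x * y) = scl A c x * y" "x * scl A c y = scl A c (x * y)"
  using algebra_A unfolding algebra_over_def by metis+

lemma frag_eval_relation: "f \<in> tensor_relations \<iota> (scl A) (scl B) \<Longrightarrow> frag_eval \<beta> f = 0"
  using tensor by (auto simp: is_tensor_product_def)

lemma
  shows tensor_add_left: "\<beta> (a + a') b = \<beta> a b + \<beta> a' b"
    and tensor_add_right: "\<beta> a (b + b') = \<beta> a b + \<beta> a b'"
    and tensor_balanced: "\<beta> (scl A c a) b = \<beta> a (scl B (\<iota> c) b)"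
proof -
  have "frag_eval \<beta> (frag_of (a + a', b) - frag_of (a, b) - frag_of (a', b)) = 0"
    by (rule frag_eval_relation) (unfold tensor_relations_def, rule group_closure.base, blast)
  then show "\<beta> (a + a') b = \<beta> a b + \<beta> a' b"
    by (simp only: frag_eval_diff frag_eval_frag_of fst_conv snd_conv) (simp add: algebra_simps)
  have "frag_eval \<beta> (frag_of (a, b + b') - frag_of (a, b) - frag_of (a, b')) = 0"
    by (rule frag_eval_relation) (unfold tensor_relations_def, rule group_closure.base, blast)
  then show "\<beta> a (b + b') = \<beta> a b + \<beta> a b'"
    by (simp only: frag_eval_diff frag_eval_frag_of fst_conv snd_conv) (simp add: algebra_simps)
  have "frag_eval \<beta> (frag_of (scl A c a, b) - frag_of (a, scl B (\<iota> c) b)) = 0"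
    by (rule frag_eval_relation) (unfold tensor_relations_def, rule group_closure.base, blast)
  then show "\<beta> (scl A c a) b = \<beta> a (scl B (\<iota> c) b)"
    by (simp add: frag_eval_diff)
qed

lemma tensor_one [simp]: "\<beta> 1 1 = 1"
  and tensor_mult: "\<beta> a b * \<beta> a' b' = \<beta> (a * a') (b * b')"
  and scl_tensor: "scl T d (\<beta> a b) = \<beta> a (scl B d b)"
  and invol_tensor: "invol T (\<beta> a b) = \<beta> (invol A a) (invol B b)"
  and additive_invol: "additive (invol T)"
  using tensor by (simp_all add: is_tensor_product_def)

lemma additive_left: "additive (\<lambda>a. \<beta> a b)" and additive_right: "additive (\<beta> a)"
  by (simp_all add: additive_def tensor_add_left tensor_add_right)

lemmas tensor_sum_left = additive.sum[OF additive_left]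
lemmas tensor_diff_right = additive.diff[OF additive_right]
lemmas tensor_zero_right [simp] = additive.zero[OF additive_right]
lemmas tensor_minus_left = additive.minus[OF additive_left]

text \<open>Pure tensors generate \<open>T\<close> as an additive group, because
  \<open>frag_eval \<beta>\<close> is onto.\<close>

lemma tensor_induct [case_names zero tensor diff]:
  assumes "P 0" "\<And>a b. P (\<beta> a b)" "\<And>x y. P x \<Longrightarrow> P y \<Longrightarrow> P (x - y)"
  shows "P t"
proof -
  obtain f where t: "t = frag_eval \<beta> f"
    using tensor by (auto simp: is_tensor_product_def elim!: surjE)
  have "P (frag_eval \<beta> f)"
    by (rule frag_induction[of f UNIV]) (use assms in \<open>auto simp: frag_eval_diff\<close>)
  then show ?thesis by (simp add: t)
qed

text \<open>Universal property: a biadditive balanced \<open>g\<close> kills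
  \<open>tensor_relations\<close>, which is exactly the kernel of \<open>frag_eval \<beta>\<close>,
  so \<open>frag_eval g\<close> factors through \<open>T\<close>.\<close>

lemma lift_exists:
  fixes g :: "'a \<Rightarrow> 'b \<Rightarrow> 'c::ring_1"
  assumes "\<And>a a' b. g (a + a') b = g a b + g a' b" "\<And>a b b'. g a (b + b') = g a b + g a b'"
    and "\<And>c a b. g (scl A c a) b = g a (scl B (\<iota> c) b)"
  obtains R where "additive R" "\<And>a b. R (\<beta> a b) = g a b"
proof -
  define pre where "pre = inv (frag_eval \<beta>)"
  have pre: "frag_eval \<beta> (pre t) = t" for t
    using tensor by (simp add: is_tensor_product_def pre_def surj_f_inv_f)
  have ker: "frag_eval g f = 0" if "f \<in> tensor_relations \<iota> (scl A) (scl B)" for f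
    using that unfolding tensor_relations_def
  proof induction
    case (base f)
    then show ?case by (elim insertE UnE CollectE exE conjE) (simp_all add: frag_eval_diff assms)
  qed (simp add: frag_eval_diff)
  have eq: "frag_eval g f = frag_eval g f'" if "frag_eval \<beta> f = frag_eval \<beta> f'" for f f'
  proof -
    have "frag_eval \<beta> (f - f') = 0" by (simp add: frag_eval_diff that)
    then have "f - f' \<in> tensor_relations \<iota> (scl A) (scl B)"
      using tensor by (auto simp: is_tensor_product_def)
    from ker[OF this] show ?thesis by (simp add: frag_eval_diff)
  qed
  define R where "R t = frag_eval g (pre t)" for t
  have R: "R (frag_eval \<beta> f) = frag_eval g f" for f
    unfolding R_def by (rule eq) (rule pre)
  have R_diff: "R (s - t) = R s - R t" for s t
    using R[of "pre s - pre t"] by (simp add: frag_eval_diff pre R_def)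
  have "additive R"
  proof
    fix s t
    have "R (s + t) = R (s + t - t) + R t" by (subst R_diff) simp
    then show "R (s + t) = R s + R t" by simp
  qed
  moreover have "R (\<beta> a b) = g a b" for a b
    using R[of "frag_of (a, b)"] by simp
  ultimately show ?thesis by (rule that)
qed

text \<open>This \<open>R\<close> is id \<otimes> l followed by the identification of A \<otimes> F
  with A.\<close>

lemma functional_lift:
  assumes "base_linear \<iota> (scl B) l"
  obtains R where "additive R" "\<And>a b. R (\<beta> a b) = scl A (l b) a"
proof (rule lift_exists[of "\<lambda>a b. scl A (l b) a"])
  show "scl A (l b) (a + a') = scl A (l b) a + scl A (l b) a'" for a a' b
    by (rule A.scale_right_distrib)
  show "scl A (l (b + b')) a = scl A (l b) a + scl A (l b') a" for a b b'
    using assms by (simp add: base_linear_def A.scale_left_distrib)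
  show "scl A (l b) (scl A c a) = scl A (l (scl B (\<iota> c) b)) a" for a b c
    using assms by (simp add: base_linear_def mult.commute)
qed (rule that)

text \<open>The coordinates of \<open>a\<close> in the basis lie in \<open>F\<close> and can be
  moved across the tensor sign, so all coefficients end up in \<open>B\<close>.\<close>

lemma basis_expansion:
  assumes "finite E" "A.independent E" "A.span E = UNIV"
  shows "\<exists>h. t = (\<Sum>e\<in>E. \<beta> e (h e))"
proof (induction t rule: tensor_induct)
  case zero
  then show ?case by (intro exI[of _ "\<lambda>_. 0"]) simp
next
  case (tensor a b)
  have "\<beta> a b = \<beta> (\<Sum>e\<in>E. scl A (A.representation E a e) e) b"
    using assms by (simp add: A.sum_representation_eq)
  also have "\<dots> = (\<Sum>e\<in>E. \<beta> e (scl B (\<iota> (A.representation E a e)) b))"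
    by (simp add: tensor_sum_left tensor_balanced)
  finally show ?case by (rule exI[of _ "\<lambda>e. scl B (\<iota> (A.representation E a e)) b"])
next
  case (diff x y)
  then obtain h h' where "x = (\<Sum>e\<in>E. \<beta> e (h e))" "y = (\<Sum>e\<in>E. \<beta> e (h' e))" by blast
  then have "x - y = (\<Sum>e\<in>E. \<beta> e (h e - h' e))"
    by (simp add: tensor_diff_right sum_subtractf)
  then show ?case by (rule exI[of _ "\<lambda>e. h e - h' e"])
qed

text \<open>\<open>is_tensor_product\<close> prescribes the involution only by additivity and its
  values on pure tensors; the remaining laws spread from there by
  \<open>tensor_induct\<close>.\<close>

lemma is_involution_tensor:
  assumes "is_involution A" "is_involution B"
  shows "is_involution T"
proof -
  interpret iA: Vector_Spaces.linear "scl A" "scl A" "invol A"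
    using assms by (simp add: is_involution_def)
  interpret iB: Vector_Spaces.linear "scl B" "scl B" "invol B"
    using assms by (simp add: is_involution_def)
  have anti: "invol A (x * y) = invol A y * invol A x" "invol A (invol A x) = x"
      "invol B (b * b') = invol B b' * invol B b" "invol B (invol B b) = b" for x y b b'
    using assms by (auto simp: is_involution_def)
  interpret additive "invol T" by (rule additive_invol)
  have scl: "invol T (scl T d t) = scl T d (invol T t)" for d t
    by (induction t rule: tensor_induct)
       (simp_all add: zero diff T.scale_right_diff_distrib scl_tensor invol_tensor iB.scale)
  have "Vector_Spaces.linear (scl T) (scl T) (invol T)"
    by unfold_locales (simp_all add: add scl)
  moreover have "invol T (s * t) = invol T t * invol T s" for s t
  proof (induction s rule: tensor_induct)
    case (tensor a b)
    show ?case
      by (induction t rule: tensor_induct)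
         (simp_all add: zero diff right_diff_distrib left_diff_distrib tensor_mult invol_tensor anti)
  qed (simp_all add: zero diff right_diff_distrib left_diff_distrib)
  moreover have "invol T (invol T t) = t" for t
    by (induction t rule: tensor_induct) (simp_all add: zero diff invol_tensor anti)
  ultimately show ?thesis by (simp add: is_involution_def)
qed

lemma quaternion_pair_tensor:
  assumes "quaternion_pair A a b I J" "invol B 1 = 1"
  shows "quaternion_pair T (\<iota> a) (\<iota> b) (\<beta> I 1) (\<beta> J 1)"
proof -
  have "\<beta> (scl A c 1) 1 = scl T (\<iota> c) 1" for c
    by (simp add: tensor_balanced flip: scl_tensor)
  with assms show ?thesis
    by (simp add: quaternion_pair_def tensor_mult invol_tensor tensor_minus_left)
qed

end

section \<open>Descent along functionals of rank one\<close>

text \<open>On \<open>S\<close> the pairing l(\<rho>(h) k) is the rank one form m \<otimes> m. It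
  will be used for the finite set of coordinates of one element of the tensor product.\<close>

definition rank_one_on ::
    "('f::field \<Rightarrow> 'k) \<Rightarrow> ('k, 'b::ring_1) alg_inv \<Rightarrow> 'b set \<Rightarrow> ('b \<Rightarrow> 'f) \<Rightarrow> ('b \<Rightarrow> 'f) \<Rightarrow> bool" where
  "rank_one_on \<iota> B S l m \<longleftrightarrow> base_linear \<iota> (scl B) l \<and> base_linear \<iota> (scl B) m \<and>
     (\<exists>h\<in>S. m h \<noteq> 0) \<and> (\<forall>h\<in>S. \<forall>k\<in>S. l (invol B h * k) = m h * m k)"

text \<open>Models the residue map of a valuation ring or order \<open>V\<close>, with the
  involution acting trivially on residues.\<close>

definition residue_on ::
    "('f::field \<Rightarrow> 'k) \<Rightarrow> ('k, 'b::ring_1) alg_inv \<Rightarrow> 'b set \<Rightarrow> ('b \<Rightarrow> 'f) \<Rightarrow> bool" where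
  "residue_on \<iota> B V r \<longleftrightarrow> base_linear \<iota> (scl B) r \<and> r 1 = 1 \<and>
     (\<forall>h\<in>V. \<forall>k\<in>V. r (h * k) = r h * r k) \<and> (\<forall>h\<in>V. r (invol B h) = r h)"

locale anisotropic_tensor = tensor_product +
  assumes csa: "csa_with_involution A" and anisotropic_A: "anisotropic A"
begin

sublocale invol_A: Vector_Spaces.linear "scl A" "scl A" "invol A"
  using csa by (simp add: csa_with_involution_def is_involution_def)

lemma finite_basis:
  obtains E where "finite E" "A.independent E" "A.span E = UNIV"
proof -
  obtain C where C: "finite C" "A.span C = UNIV"
    using csa by (auto simp: csa_with_involution_def central_simple_algebra_def)
  obtain E where E: "E \<subseteq> C" "A.independent E" "C \<subseteq> A.span E"
    using A.maximal_independent_subset[of C] by blast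
  have "A.span E = UNIV"
    using A.span_minimal[OF E(3) A.subspace_span] C(2) by auto
  with that C(1) E show ?thesis by (blast intro: finite_subset)
qed

text \<open>The rank one property turns the image of \<open>invol T t * t\<close> into
  \<open>invol A z * z\<close> with z = (id \<otimes> m)(t), and independence of \<open>E\<close>
  makes \<open>z\<close> nonzero.\<close>

lemma functional_norm:
  assumes E: "finite E" "A.independent E" and t: "t = (\<Sum>e\<in>E. \<beta> e (h e))"
    and lm: "rank_one_on \<iota> B (h ` E) l m"
    and R: "additive R" "\<And>a b. R (\<beta> a b) = scl A (l b) a"
  shows "R (invol T t * t) \<noteq> 0"
proof -
  define z where "z = (\<Sum>e\<in>E. scl A (m (h e)) e)"
  have "z \<noteq> 0"
  proof
    assume "z = 0"
    then have "\<forall>e\<in>E. m (h e) = 0"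
      using A.independentD[OF E(2) E(1) order_refl, of "\<lambda>e. m (h e)"] by (auto simp: z_def)
    then show False using lm by (auto simp: rank_one_on_def)
  qed
  then have z: "invol A z * z \<noteq> 0"
    using anisotropic_A by (auto simp: isotropic_def)
  have "invol T t * t = (\<Sum>e\<in>E. \<Sum>f\<in>E. \<beta> (invol A e * f) (invol B (h e) * h f))"
    by (simp add: t additive.sum[OF additive_invol] sum_product invol_tensor tensor_mult)
  also have "R \<dots> = (\<Sum>e\<in>E. \<Sum>f\<in>E. scl A (m (h e) * m (h f)) (invol A e * f))"
    using lm by (simp add: additive.sum[OF R(1)] R(2) rank_one_on_def)
  also have "\<dots> = (\<Sum>e\<in>E. \<Sum>f\<in>E. invol A (scl A (m (h e)) e) * scl A (m (h f)) f)"
    by (simp add: invol_A.scale scl_mult(2) mult.commute flip: scl_mult(1))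
  also have "\<dots> = invol A z * z"
    by (simp add: z_def invol_A.sum sum_product)
  finally show ?thesis using z by simp
qed

lemma anisotropic_tensor:
  assumes "\<And>S. finite S \<Longrightarrow> \<exists>h\<in>S. h \<noteq> 0 \<Longrightarrow> \<exists>l m. rank_one_on \<iota> B S l m"
  shows "anisotropic T"
proof
  assume "isotropic T"
  then obtain t where t: "t \<noteq> 0" "invol T t * t = 0" by (auto simp: isotropic_def)
  obtain E where E: "finite E" "A.independent E" "A.span E = UNIV" by (rule finite_basis)
  from basis_expansion[OF E] obtain h where h: "t = (\<Sum>e\<in>E. \<beta> e (h e))" by blast
  have "\<exists>e\<in>E. h e \<noteq> 0"
    using t(1) unfolding h by (rule contrapos_np) (auto intro: sum.neutral)
  with assms[of "h ` E"] E(1) obtain l m where lm: "rank_one_on \<iota> B (h ` E) l m" by auto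
  then have "base_linear \<iota> (scl B) l" by (simp add: rank_one_on_def)
  then obtain R where R: "additive R" "\<And>a b. R (\<beta> a b) = scl A (l b) a" by (rule functional_lift) blast
  from functional_norm[OF E(1,2) h lm R] show False
    by (simp add: t(2) additive.zero[OF R(1)])
qed

text \<open>The map id \<otimes> r is known to be multiplicative only on elements with coordinates
  in \<open>V\<close>, so the generators are first shown to be of that kind.\<close>

lemma quaternion_pair_descends:
  assumes V: "\<And>S. finite S \<Longrightarrow> \<not> S \<subseteq> V \<Longrightarrow> \<exists>l m. rank_one_on \<iota> B S l m \<and> l 1 = 0"
    and r: "residue_on \<iota> B V r"
    and IJ: "quaternion_pair T (\<iota> a) (\<iota> b) I J"
  shows "\<exists>I J. quaternion_pair A a b I J"
proof -
  obtain E where E: "finite E" "A.independent E" "A.span E = UNIV" by (rule finite_basis)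
  \<comment> \<open>For such \<open>t\<close> the product \<open>invol T t * t\<close> is a
    constant, which id \<otimes> l kills when \<open>l 1 = 0\<close>. A coordinate outside
    \<open>V\<close> would therefore contradict \<open>functional_norm\<close>.\<close>
  have coords: "\<exists>h. t = (\<Sum>e\<in>E. \<beta> e (h e)) \<and> h ` E \<subseteq> V"
    if t: "t * t = scl T (\<iota> c) 1" "invol T t = - t" for t c
  proof -
    from basis_expansion[OF E] obtain h where h: "t = (\<Sum>e\<in>E. \<beta> e (h e))" by blast
    have "h ` E \<subseteq> V"
    proof (rule ccontr)
      assume "\<not> h ` E \<subseteq> V"
      with V E(1) obtain l m where lm: "rank_one_on \<iota> B (h ` E) l m" "l 1 = 0" by blast
      then have l: "base_linear \<iota> (scl B) l" by (simp add: rank_one_on_def)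
      then obtain R where R: "additive R" "\<And>a b. R (\<beta> a b) = scl A (l b) a"
        by (rule functional_lift) blast
      have "R (scl T (\<iota> c) 1) = R (\<beta> 1 (scl B (\<iota> c) 1))"
        by (simp flip: scl_tensor)
      also have "\<dots> = 0"
        using l lm(2) by (simp add: R(2) base_linear_def)
      finally have "R (invol T t * t) = 0"
        by (simp add: t additive.minus[OF R(1)])
      with functional_norm[OF E(1,2) h lm(1) R] show False by simp
    qed
    with h show ?thesis by blast
  qed
  have rl: "base_linear \<iota> (scl B) r" using r by (simp add: residue_on_def)
  then obtain R where R: "additive R" "\<And>a b. R (\<beta> a b) = scl A (r b) a" by (rule functional_lift) blast
  have R_scl: "R (scl T (\<iota> c) 1) = scl A c 1" for c
  proof -
    have "R (scl T (\<iota> c) 1) = R (\<beta> 1 (scl B (\<iota> c) 1))"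
      by (simp flip: scl_tensor)
    also have "\<dots> = scl A c 1"
      using r rl by (simp add: R(2) base_linear_def residue_on_def)
    finally show ?thesis .
  qed
  have R_mult: "R (s * t) = R s * R t" if "s = (\<Sum>e\<in>E. \<beta> e (h e))" "h ` E \<subseteq> V"
    "t = (\<Sum>e\<in>E. \<beta> e (k e))" "k ` E \<subseteq> V" for s t h k
  proof -
    have "R (s * t) = (\<Sum>e\<in>E. \<Sum>f\<in>E. scl A (r (h e * k f)) (e * f))"
      by (simp add: that sum_product tensor_mult additive.sum[OF R(1)] R(2))
    also have "\<dots> = (\<Sum>e\<in>E. \<Sum>f\<in>E. scl A (r (h e)) e * scl A (r (k f)) f)"
    proof (intro sum.cong refl)
      fix e f assume "e \<in> E" "f \<in> E"
      then have "r (h e * k f) = r (h e) * r (k f)"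
        using r that by (auto simp: residue_on_def image_subset_iff)
      then show "scl A (r (h e * k f)) (e * f) = scl A (r (h e)) e * scl A (r (k f)) f"
        by (simp add: scl_mult(2) mult.commute flip: scl_mult(1))
    qed
    also have "\<dots> = R s * R t"
      by (simp add: that sum_product additive.sum[OF R(1)] R(2))
    finally show ?thesis .
  qed
  have R_invol: "R (invol T t) = invol A (R t)"
    if "t = (\<Sum>e\<in>E. \<beta> e (h e))" "h ` E \<subseteq> V" for t h
    using r that
    by (auto simp: invol_A.sum invol_A.scale additive.sum[OF R(1)] additive.sum[OF additive_invol]
        invol_tensor R(2) residue_on_def image_subset_iff intro!: sum.cong)
  obtain h k where h: "I = (\<Sum>e\<in>E. \<beta> e (h e))" "h ` E \<subseteq> V"
    and k: "J = (\<Sum>e\<in>E. \<beta> e (k e))" "k ` E \<subseteq> V"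
    using IJ coords unfolding quaternion_pair_def by metis
  have "quaternion_pair A a b (R I) (R J)"
    using IJ R_mult[OF h h] R_mult[OF h k] R_mult[OF k h] R_mult[OF k k]
      R_invol[OF h] R_invol[OF k]
    by (simp add: quaternion_pair_def R_scl additive.minus[OF R(1)])
  then show ?thesis by blast
qed

end

section \<open>Quaternion subalgebras and pairs of generators\<close>

lemma quat_mult_table:
  fixes I J x y :: "'a::ring_1"
  assumes s: "algebra_over s" and rel: "I * I = s a 1" "J * J = s b 1" "J * I = - (I * J)"
  shows "I * (I * J) = s a J" "(I * J) * I = s (- a) J" "(I * J) * J = s b I" "J * (I * J) = s (- b) I"
    "(I * J) * (I * J) = s (- (a * b)) 1"
proof -
  interpret vector_space s using s by (simp add: algebra_over_def)
  have mult: "s c x * y = s c (x * y)" "x * s c y = s c (x * y)" for c x y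
    using s unfolding algebra_over_def by metis+
  show 1: "I * (I * J) = s a J" by (simp add: rel mult flip: mult.assoc)
  show 2: "(I * J) * I = s (- a) J" by (simp add: rel 1 mult.assoc)
  show 3: "(I * J) * J = s b I" by (simp add: rel mult mult.assoc)
  have "J * (I * J) = - (I * J) * J" by (simp add: rel flip: mult.assoc)
  then show 4: "J * (I * J) = s (- b) I" by (simp add: 3)
  show "(I * J) * (I * J) = s (- (a * b)) 1" by (simp add: mult.assoc 4 mult rel mult.commute)
qed

lemma quat_comb_mult:
  fixes I J :: "'a::ring_1"
  assumes s: "algebra_over s" and rel: "I * I = s a 1" "J * J = s b 1" "J * I = - (I * J)"
  shows "quat_comb s I J (c0, c1, c2, c3) * quat_comb s I J (d0, d1, d2, d3) =
    quat_comb s I J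
     (c0 * d0 + a * c1 * d1 + b * c2 * d2 - a * b * c3 * d3,
      c0 * d1 + c1 * d0 - b * c2 * d3 + b * c3 * d2,
      c0 * d2 + c2 * d0 + a * c1 * d3 - a * c3 * d1,
      c0 * d3 + c3 * d0 + c1 * d2 - c2 * d1)"
proof -
  interpret vector_space s using s by (simp add: algebra_over_def)
  have mult: "s c x * y = s c (x * y)" "x * s c y = s c (x * y)" for c x y
    using s unfolding algebra_over_def by metis+
  show ?thesis
    unfolding quat_comb_def prod.case
    by (simp add: distrib_left distrib_right mult quat_mult_table[OF s rel] rel scale_left_distrib
        scale_left_diff_distrib scale_minus_left scale_minus_right, simp add: algebra_simps)
qed

lemma quat_comb_add:
  assumes "algebra_over s"
  shows "quat_comb s I J (c0 + d0, c1 + d1, c2 + d2, c3 + d3) =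
    quat_comb s I J (c0, c1, c2, c3) + quat_comb s I J (d0, d1, d2, d3)"
proof -
  interpret vector_space s using assms by (simp add: algebra_over_def)
  show ?thesis by (simp add: quat_comb_def scale_left_distrib algebra_simps)
qed

lemma quat_comb_scale:
  assumes "algebra_over s"
  shows "quat_comb s I J (c * d0, c * d1, c * d2, c * d3) = s c (quat_comb s I J (d0, d1, d2, d3))"
proof -
  interpret vector_space s using assms by (simp add: algebra_over_def)
  show ?thesis by (simp add: quat_comb_def scale_right_distrib)
qed

text \<open>The relations alone force independence: \<open>coeff0\<close> kills the scalar
  coefficient of a dependency, and right multiplication by \<open>I\<close>, \<open>J\<close>,
  \<open>I * J\<close> brings the other coefficients, up to nonzero factors, into scalar
  position.\<close>

lemma quat_comb_eq_zero:
  fixes I J :: "'a::ring_1"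
  assumes two: "(2::'k::field) \<noteq> 0" and ab: "a \<noteq> 0" "b \<noteq> 0"
    and s: "algebra_over (s :: 'k \<Rightarrow> 'a \<Rightarrow> 'a)"
    and rel: "I * I = s a 1" "J * J = s b 1" "J * I = - (I * J)"
    and zero: "quat_comb s I J (c0, c1, c2, c3) = 0"
  shows "c0 = 0 \<and> c1 = 0 \<and> c2 = 0 \<and> c3 = 0"
proof -
  interpret vector_space s using s by (simp add: algebra_over_def)
  let ?q = "quat_comb s I J"
  note mult = quat_comb_mult[OF s rel]
  have q: "?q (0, 1, 0, 0) = I" "?q (0, 0, 1, 0) = J" "?q (0, 0, 0, 1) = I * J"
    by (simp_all add: quat_comb_def)
  have left: "I * ?q (d0, d1, d2, d3) = ?q (a * d1, d0, a * d3, d2)"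
    "J * ?q (d0, d1, d2, d3) = ?q (b * d2, - b * d3, d0, - d1)" for d0 d1 d2 d3
    using mult[of 0 1 0 0 d0 d1 d2 d3] mult[of 0 0 1 0 d0 d1 d2 d3] by (simp_all add: q)
  have right: "?q (d0, d1, d2, d3) * I = ?q (a * d1, d0, - a * d3, - d2)"
    "?q (d0, d1, d2, d3) * J = ?q (b * d2, b * d3, d0, d1)"
    "?q (d0, d1, d2, d3) * (I * J) = ?q (- (a * b * d3), - (b * d2), a * d1, d0)" for d0 d1 d2 d3
    using mult[of d0 d1 d2 d3 0 1 0 0] mult[of d0 d1 d2 d3 0 0 1 0] mult[of d0 d1 d2 d3 0 0 0 1]
    by (simp_all add: q)
  \<comment> \<open>\<open>z \<mapsto> (I z I + a z) / 2a\<close> is the projection of \<open>\<langle>1, I, J, I J\<rangle>\<close> onto \<open>\<langle>1, I\<rangle>\<close>; similarly for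
    \<open>J\<close>, and the two together project onto the scalars.\<close>
  have coeff0: "d0 = 0" if d: "?q (d0, d1, d2, d3) = 0" for d0 d1 d2 d3
  proof -
    have "I * ?q (d0, d1, d2, d3) * I + s a (?q (d0, d1, d2, d3)) = ?q (2 * a * d0, 2 * a * d1, 0, 0)"
      by (simp add: left right mult.assoc mult.left_commute flip: quat_comb_scale[OF s] quat_comb_add[OF s])
    then have 1: "?q (2 * a * d0, 2 * a * d1, 0, 0) = 0" by (simp add: d)
    have "J * ?q (2 * a * d0, 2 * a * d1, 0, 0) * J + s b (?q (2 * a * d0, 2 * a * d1, 0, 0)) =
        ?q (2 * 2 * a * b * d0, 0, 0, 0)"
      by (simp add: left right mult.assoc mult.left_commute flip: quat_comb_scale[OF s] quat_comb_add[OF s])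
    then have "?q (2 * 2 * a * b * d0, 0, 0, 0) = 0" unfolding 1 by simp
    then have "2 * 2 * a * b * d0 = 0" by (simp add: quat_comb_def)
    then show ?thesis using two ab by (simp only: mult_eq_0_iff) blast
  qed
  have "?q (a * c1, c0, - a * c3, - c2) = 0" "?q (b * c2, b * c3, c0, c1) = 0"
    "?q (- (a * b * c3), - (b * c2), a * c1, c0) = 0"
    using right[of c0 c1 c2 c3] by (simp_all add: zero)
  from this[THEN coeff0] coeff0[OF zero] show ?thesis using ab by simp
qed

lemma inj_quat_comb:
  assumes "(2::'k::field) \<noteq> 0" "a \<noteq> 0" "b \<noteq> 0" "algebra_over (s :: 'k \<Rightarrow> 'a::ring_1 \<Rightarrow> 'a)"
    "I * I = s a 1" "J * J = s b 1" "J * I = - (I * J)"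
  shows "inj (quat_comb s I J)"
proof (rule injI)
  fix p q assume "quat_comb s I J p = quat_comb s I J q"
  moreover obtain c0 c1 c2 c3 where p: "p = (c0, c1, c2, c3)" by (metis prod_cases4)
  moreover obtain d0 d1 d2 d3 where q: "q = (d0, d1, d2, d3)" by (metis prod_cases4)
  ultimately have eq: "quat_comb s I J (c0, c1, c2, c3) = quat_comb s I J (d0, d1, d2, d3)" by simp
  have "quat_comb s I J (c0 - d0, c1 - d1, c2 - d2, c3 - d3) = 0"
    using eq quat_comb_add[OF assms(4), of I J "c0 - d0" d0 "c1 - d1" d1 "c2 - d2" d2 "c3 - d3" d3] by simp
  from quat_comb_eq_zero[OF assms this]
  show "p = q" by (simp add: p q)
qed

text \<open>The conjugator is absorbed into the generators: the conjugate of the canonical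
  involution by \<open>g\<close> negates \<open>g * i * h\<close> and
  \<open>g * j * h\<close>.\<close>

lemma quaternion_pair_if_contains:
  fixes A :: "('k::field, 'a::ring_1) alg_inv" and Q :: "('k, 'q::ring_1) alg_inv"
  assumes Q: "quaternion_algebra (scl Q) a b i j" "is_quat_conj Q i j"
    and contains: "contains_alg_inv A Q"
  shows "\<exists>I J. quaternion_pair A a b I J"
proof -
  obtain \<phi> g h where hom: "algebra_hom (scl Q) (scl A) \<phi>" and gh: "g * h = 1" "h * g = 1"
    and invol: "invol A (\<phi> q) = \<phi> (g * invol Q (h * q * g) * h)" for q
    using contains unfolding contains_alg_inv_def by metis
  interpret phi: Vector_Spaces.linear "scl Q" "scl A" \<phi>
    using hom by (simp add: algebra_hom_def)
  have hom: "\<phi> (x * y) = \<phi> x * \<phi> y" "\<phi> 1 = 1" for x y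
    using hom by (simp_all add: algebra_hom_def)
  have rel: "i * i = scl Q a 1" "j * j = scl Q b 1" "j * i = - (i * j)" and s: "algebra_over (scl Q)"
    using Q(1) by (simp_all add: quaternion_algebra_def)
  have mult: "scl Q c x * y = scl Q c (x * y)" "x * scl Q c y = scl Q c (x * y)" for c x y
    using s unfolding algebra_over_def by metis+
  have gh': "h * (g * x) = x" "g * (h * x) = x" for x
    by (simp_all add: gh flip: mult.assoc)
  have conj_bar: "invol Q i = - i" "invol Q j = - j"
    using Q(2)[unfolded is_quat_conj_def, rule_format, of 0 1 0 0]
      Q(2)[unfolded is_quat_conj_def, rule_format, of 0 0 1 0] by (simp_all add: quat_comb_def)
  have "quaternion_pair A a b (\<phi> (g * i * h)) (\<phi> (g * j * h))"
    by (simp add: quaternion_pair_def invol phi.scale flip: hom phi.neg,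
        simp add: mult.assoc gh gh' conj_bar mult,
        simp add: rel mult gh flip: mult.assoc, simp add: mult.assoc hom phi.scale phi.neg flip: hom)
  then show ?thesis by blast
qed

text \<open>The embedding sends i to I and j to J, with conjugator 1; it is injective by
  \<open>inj_quat_comb\<close>.\<close>

lemma contains_if_quaternion_pair:
  fixes A :: "('k::field, 'a::ring_1) alg_inv" and Q :: "('k, 'q::ring_1) alg_inv"
  assumes two: "(2::'k) \<noteq> 0" and A: "algebra_over (scl A)" "is_involution A"
    and Q: "quaternion_algebra (scl Q) a b i j" "is_quat_conj Q i j"
    and IJ: "quaternion_pair A a b I J"
  shows "contains_alg_inv A Q"
proof -
  let ?q = "quat_comb (scl Q) i j" and ?p = "quat_comb (scl A) I J"
  have bij: "bij ?q" and ab: "a \<noteq> 0" "b \<noteq> 0" and sQ: "algebra_over (scl Q)"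
    and relQ: "i * i = scl Q a 1" "j * j = scl Q b 1" "j * i = - (i * j)"
    using Q(1) by (simp_all add: quaternion_algebra_def)
  interpret A: vector_space "scl A" using A(1) by (simp add: algebra_over_def)
  interpret Q: vector_space "scl Q" using sQ by (simp add: algebra_over_def)
  interpret inv_A: Vector_Spaces.linear "scl A" "scl A" "invol A"
    using A(2) by (simp add: is_involution_def)
  have relA: "I * I = scl A a 1" "J * J = scl A b 1" "J * I = - (I * J)"
    and bar: "invol A I = - I" "invol A J = - J"
    using IJ by (simp_all add: quaternion_pair_def)
  have anti: "invol A (x * y) = invol A y * invol A x" "invol A (invol A x) = x" for x y
    using A(2) by (simp_all add: is_involution_def)
  have "invol A 1 = 1"
    using anti(1)[of "invol A 1" 1] anti(2)[of 1] by simp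
  define \<phi> where "\<phi> x = ?p (inv ?q x)" for x
  have phi: "\<phi> (?q c) = ?p c" for c
    using bij by (simp add: \<phi>_def bij_is_inj inv_f_f)
  have cases: "\<exists>c0 c1 c2 c3. x = ?q (c0, c1, c2, c3)" for x
    using bij by (metis bij_is_surj prod_cases4 surjD)
  have add: "\<phi> (x + y) = \<phi> x + \<phi> y" for x y
    using cases[of x] cases[of y]
    by (auto simp: phi quat_comb_add[OF A(1)] simp flip: quat_comb_add[OF sQ])
  have scale: "\<phi> (scl Q c x) = scl A c (\<phi> x)" for c x
    using cases[of x]
    by (auto simp: phi quat_comb_scale[OF A(1)] simp flip: quat_comb_scale[OF sQ])
  have mult: "\<phi> (x * y) = \<phi> x * \<phi> y" for x y
    using cases[of x] cases[of y]
    by (auto simp: phi quat_comb_mult[OF A(1) relA] quat_comb_mult[OF sQ relQ])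
  have one: "\<phi> 1 = 1"
    using phi[of "(1, 0, 0, 0)"] by (simp add: quat_comb_def)
  have hom: "algebra_hom (scl Q) (scl A) \<phi>"
    unfolding algebra_hom_def by (intro conjI allI mult one) (unfold_locales, simp_all add: add scale)
  have invol: "invol A (\<phi> x) = \<phi> (invol Q x)" for x
  proof -
    obtain c0 c1 c2 c3 where x: "x = ?q (c0, c1, c2, c3)" using cases by blast
    have "invol Q x = ?q (c0, - c1, - c2, - c3)" using Q(2) by (simp add: is_quat_conj_def x)
    then show ?thesis
      by (simp add: x phi) (simp add: quat_comb_def inv_A.add inv_A.scale anti bar relA \<open>invol A 1 = 1\<close>)
  qed
  have "inj ?p" using inj_quat_comb[OF two ab A(1) relA] .
  moreover have "inj (inv ?q)" using bij by (intro surj_imp_inj_inv bij_is_surj)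
  ultimately have "inj \<phi>" unfolding \<phi>_def inj_def by blast
  moreover have "subalgebra (scl A) (range \<phi>)"
    unfolding subalgebra_def
  proof (intro conjI ballI)
    show "A.subspace (range \<phi>)"
    proof (rule A.subspaceI)
      show "0 \<in> range \<phi>" using scale[of 0 1] by (auto intro: range_eqI[of _ _ 0])
    qed (auto simp flip: add scale)
    show "1 \<in> range \<phi>" using one by (metis rangeI)
  qed (auto simp flip: mult)
  moreover have "invol A ` range \<phi> \<subseteq> range \<phi>" by (auto simp: invol)
  ultimately show ?thesis
    unfolding contains_alg_inv_def
    by (intro exI[of _ "range \<phi>"] exI[of _ \<phi>] exI[of _ 1])
       (simp add: hom invol bij_betw_def)
qed

text \<open>Makes the two preceding criteria applicable over \<open>K\<close>. The images of 1, i,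
  j, ij span \<open>QK\<close> because coefficients from \<open>F\<close> become scalars of
  \<open>QK\<close> through \<iota>; they are independent by \<open>inj_quat_comb\<close>.\<close>

lemma
  fixes Q :: "('f::field, 'q::ring_1) alg_inv" and QK :: "('k::field, 'qk::ring_1) alg_inv"
  assumes two: "(2::'k) \<noteq> 0" and Q: "quaternion_algebra (scl Q) a b i j" "is_quat_conj Q i j"
    and QK: "is_tensor_product \<iota> Q field_alg_inv QK \<gamma>" and inj: "\<And>c. \<iota> c = 0 \<Longrightarrow> c = 0"
  shows quaternion_algebra_extend: "quaternion_algebra (scl QK) (\<iota> a) (\<iota> b) (\<gamma> i 1) (\<gamma> j 1)"
    and is_quat_conj_extend: "is_quat_conj QK (\<gamma> i 1) (\<gamma> j 1)"
proof -
  let ?q = "quat_comb (scl Q) i j" and ?p = "quat_comb (scl QK) (\<gamma> i 1) (\<gamma> j 1)"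
  have bij: "bij ?q" and ab: "a \<noteq> 0" "b \<noteq> 0" and sQ: "algebra_over (scl Q)"
    and relQ: "i * i = scl Q a 1" "j * j = scl Q b 1" "j * i = - (i * j)"
    using Q(1) by (simp_all add: quaternion_algebra_def)
  have sK: "algebra_over (scl QK)" using QK by (simp add: is_tensor_product_def)
  interpret tensor_product \<iota> Q field_alg_inv QK \<gamma> by unfold_locales (rule QK, rule sQ)
  have K [simp]: "scl (field_alg_inv :: ('k, 'k) alg_inv) = (*)" "invol (field_alg_inv :: ('k, 'k) alg_inv) c = c" for c
    by (simp_all add: field_alg_inv_def)
  have conv: "\<gamma> q c = scl QK c (\<gamma> q 1)" for q c by (simp add: scl_tensor)
  have base: "\<gamma> (scl Q c q) 1 = scl QK (\<iota> c) (\<gamma> q 1)" for c q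
    by (simp add: tensor_balanced scl_tensor)
  have rel: "\<gamma> i 1 * \<gamma> i 1 = scl QK (\<iota> a) 1" "\<gamma> j 1 * \<gamma> j 1 = scl QK (\<iota> b) 1"
    "\<gamma> j 1 * \<gamma> i 1 = - (\<gamma> i 1 * \<gamma> j 1)"
    by (simp_all add: tensor_mult relQ base tensor_minus_left)
  have \<iota>_ne: "\<iota> a \<noteq> 0" "\<iota> b \<noteq> 0" using inj ab by auto
  have "surj ?p"
  proof -
    have "\<exists>c0 c1 c2 c3. t = ?p (c0, c1, c2, c3)" for t
    proof (induction t rule: tensor_induct)
      case zero
      show ?case by (intro exI[of _ 0]) (simp add: quat_comb_def)
    next
      case (tensor q c)
      obtain c0 c1 c2 c3 where q: "q = ?q (c0, c1, c2, c3)"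
        using bij by (metis bij_is_surj prod_cases4 surjD)
      have "\<gamma> q c = scl QK c (?p (\<iota> c0, \<iota> c1, \<iota> c2, \<iota> c3))"
        by (subst conv) (simp add: q quat_comb_def tensor_add_left base tensor_mult)
      then show ?case by (auto simp flip: quat_comb_scale[OF sK])
    next
      case (diff x y)
      then obtain c0 c1 c2 c3 d0 d1 d2 d3
        where "x = ?p (c0, c1, c2, c3)" "y = ?p (d0, d1, d2, d3)" by blast
      then have "x - y = ?p (c0 - d0, c1 - d1, c2 - d2, c3 - d3)"
        using quat_comb_add[OF sK, of "\<gamma> i 1" "\<gamma> j 1" "c0 - d0" d0 "c1 - d1" d1 "c2 - d2" d2 "c3 - d3" d3] by simp
      then show ?case by blast
    qed
    then show ?thesis unfolding surj_def by fast
  qed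
  moreover have "inj ?p" by (rule inj_quat_comb[OF two \<iota>_ne sK rel])
  ultimately show "quaternion_algebra (scl QK) (\<iota> a) (\<iota> b) (\<gamma> i 1) (\<gamma> j 1)"
    by (simp add: quaternion_algebra_def sK \<iota>_ne rel bij_def)
  have conj_bar: "invol Q (?q (c0, c1, c2, c3)) = ?q (c0, - c1, - c2, - c3)" for c0 c1 c2 c3
    using Q(2) by (simp add: is_quat_conj_def)
  have bar: "invol Q 1 = 1" "invol Q i = - i" "invol Q j = - j" "invol Q (i * j) = - (i * j)"
    using conj_bar[of 1 0 0 0] conj_bar[of 0 1 0 0] conj_bar[of 0 0 1 0] conj_bar[of 0 0 0 1]
    by (simp_all add: quat_comb_def)
  have scl_invol: "invol QK (scl QK c (\<gamma> q 1)) = scl QK c (\<gamma> (invol Q q) 1)" for c q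
    by (simp add: scl_tensor invol_tensor)
  show "is_quat_conj QK (\<gamma> i 1) (\<gamma> j 1)"
    using scl_invol[of _ 1]
    by (simp add: is_quat_conj_def quat_comb_def tensor_mult additive.add[OF additive_invol]
        scl_invol bar tensor_minus_left)
qed

unbundle fps_syntax

section \<open>Fields of iterated Laurent series\<close>

text \<open>Provides the lexicographically ordered value group of F((x))((y)); the first component
  will be the exponent of y.\<close>

instance prod :: (linordered_ab_group_add, linordered_ab_group_add) linordered_ab_group_add
  by standard (auto simp: less_eq_prod_def)

text \<open>A field \<open>K\<close> of generalized power series over \<open>F\<close> with exponents in an ordered group:
  \<open>coef \<gamma> c\<close> is the coefficient of \<open>c\<close> in degree \<open>\<gamma>\<close>.\<close>

definition deg_ge :: "('g::linorder \<Rightarrow> 'k \<Rightarrow> 'f::zero) \<Rightarrow> 'g \<Rightarrow> 'k \<Rightarrow> bool" where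
  "deg_ge coef \<gamma> c \<longleftrightarrow> (\<forall>\<delta><\<gamma>. coef \<delta> c = 0)"

locale series_field =
  fixes coef :: "'g::linordered_ab_group_add \<Rightarrow> 'k::field \<Rightarrow> 'f::field" and \<iota> :: "'f \<Rightarrow> 'k"
  assumes coef_add: "coef \<gamma> (c + d) = coef \<gamma> c + coef \<gamma> d"
    and coef_one: "coef \<gamma> 1 = (if \<gamma> = 0 then 1 else 0)"
    and coef_scale: "coef \<gamma> (\<iota> t * c) = t * coef \<gamma> c"
    and leading_term: "c \<noteq> 0 \<Longrightarrow> \<exists>\<gamma>. coef \<gamma> c \<noteq> 0 \<and> deg_ge coef \<gamma> c"
    and deg_ge_mult: "deg_ge coef \<gamma> c \<Longrightarrow> deg_ge coef \<delta> d \<Longrightarrow>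
      deg_ge coef (\<gamma> + \<delta>) (c * d) \<and> coef (\<gamma> + \<delta>) (c * d) = coef \<gamma> c * coef \<delta> d"

text \<open>The bounds \<open>m\<close>, \<open>n\<close> may lie strictly below the orders of
  \<open>f\<close>, \<open>g\<close>; then the coefficient in degree \<open>m + n\<close> vanishes
  on both sides.\<close>

lemma fls_mult_nth_le:
  fixes f g :: "'k::field fls"
  assumes f: "\<And>l. l < m \<Longrightarrow> f $$ l = 0" and g: "\<And>l. l < n \<Longrightarrow> g $$ l = 0" and k: "k \<le> m + n"
  shows "(f * g) $$ k = (if k = m + n then f $$ m * g $$ n else 0)"
proof (cases "f = 0 \<or> g = 0")
  case False
  then have mn: "m \<le> fls_subdegree f" "n \<le> fls_subdegree g"
    using f g by (auto intro: fls_subdegree_geI)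
  show ?thesis
  proof (cases "k < fls_subdegree f + fls_subdegree g")
    case True
    then have "k = m + n \<Longrightarrow> m < fls_subdegree f \<or> n < fls_subdegree g" by linarith
    with True show ?thesis by (auto simp: fls_times_nth_eq0)
  next
    case False
    with mn k have "k = m + n" "m = fls_subdegree f" "n = fls_subdegree g" by linarith+
    then show ?thesis by simp
  qed
qed auto

interpretation fls_series: series_field "\<lambda>n c. c $$ n" "fls_const :: 'f::field \<Rightarrow> 'f fls"
proof
  fix c d :: "'f fls" and \<gamma> \<delta> :: int
  assume "deg_ge (\<lambda>n c. c $$ n) \<gamma> c" "deg_ge (\<lambda>n c. c $$ n) \<delta> d"
  then show "deg_ge (\<lambda>n c. c $$ n) (\<gamma> + \<delta>) (c * d) \<and> (c * d) $$ (\<gamma> + \<delta>) = c $$ \<gamma> * d $$ \<delta>"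
    by (simp add: deg_ge_def fls_mult_nth_le[of \<gamma> c \<delta> d])
next
  fix c :: "'f fls" assume "c \<noteq> 0"
  then show "\<exists>\<gamma>. c $$ \<gamma> \<noteq> 0 \<and> deg_ge (\<lambda>n c. c $$ n) \<gamma> c"
    by (intro exI[of _ "fls_subdegree c"]) (simp add: deg_ge_def)
qed auto

text \<open>Adjoins one more Laurent variable. Its exponent comes first, so the leading term is
  found by taking the lowest power of the new variable and then the leading term of its
  coefficient.\<close>

lemma series_field_fls:
  assumes "series_field coef \<iota>"
  shows "series_field (\<lambda>(n, \<gamma>) c. coef \<gamma> (c $$ n)) (\<lambda>t. fls_const (\<iota> t))" (is "series_field ?coef _")
proof -
  interpret series_field coef \<iota> by (rule assms)
  have zero: "coef \<gamma> 0 = 0" for \<gamma>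
    by (rule additive.zero) (simp add: additive_def coef_add)
  have eq_zero: "c = 0" if "\<And>\<gamma>. coef \<gamma> c = 0" for c
    using that leading_term[of c] by blast
  have deg: "deg_ge ?coef (n, \<gamma>) c \<longleftrightarrow> (\<forall>l<n. c $$ l = 0) \<and> deg_ge coef \<gamma> (c $$ n)" for n \<gamma> c
    unfolding deg_ge_def by (auto simp: zero le_less intro: eq_zero)
  show ?thesis
  proof
    fix \<gamma> c d t
    show "?coef \<gamma> (c + d) = ?coef \<gamma> c + ?coef \<gamma> d"
      "?coef \<gamma> 1 = (if \<gamma> = 0 then 1 else 0)"
      "?coef \<gamma> (fls_const (\<iota> t) * c) = t * ?coef \<gamma> c"
      by (cases \<gamma>; simp add: coef_add coef_one coef_scale zero zero_prod_def)+
  next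
    fix c :: "'b fls" assume "c \<noteq> 0"
    then have "c $$ fls_subdegree c \<noteq> 0" by simp
    then obtain \<gamma> where "coef \<gamma> (c $$ fls_subdegree c) \<noteq> 0" "deg_ge coef \<gamma> (c $$ fls_subdegree c)"
      using leading_term by blast
    then show "\<exists>\<gamma>. ?coef \<gamma> c \<noteq> 0 \<and> deg_ge ?coef \<gamma> c"
      by (intro exI[of _ "(fls_subdegree c, \<gamma>)"]) (simp add: deg)
  next
    fix \<gamma> \<delta> :: "int \<times> 'a" and c d
    assume cd: "deg_ge ?coef \<gamma> c" "deg_ge ?coef \<delta> d"
    obtain m \<mu> n \<nu> where eq: "\<gamma> = (m, \<mu>)" "\<delta> = (n, \<nu>)" by (meson surj_pair)
    have "(c * d) $$ k = (if k = m + n then c $$ m * d $$ n else 0)" if "k \<le> m + n" for k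
      using cd that by (intro fls_mult_nth_le) (auto simp: eq deg)
    then show "deg_ge ?coef (\<gamma> + \<delta>) (c * d) \<and> ?coef (\<gamma> + \<delta>) (c * d) = ?coef \<gamma> c * ?coef \<delta> d"
      using cd deg_ge_mult[of \<mu> "c $$ m" \<nu> "d $$ n"] by (simp add: eq deg)
  qed
qed

section \<open>Forms with leading coefficients of rank one\<close>

context series_field
begin

lemma additive_coef: "additive (coef \<gamma>)"
  by (simp add: additive_def coef_add)

lemmas coef_zero [simp] = additive.zero[OF additive_coef]
lemmas coef_sum = additive.sum[OF additive_coef]

lemma deg_ge_coef_nonzero: "deg_ge coef \<gamma> c \<Longrightarrow> coef \<delta> c \<noteq> 0 \<Longrightarrow> \<gamma> \<le> \<delta>"
  by (meson deg_ge_def not_le)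

end

text \<open>The form \<open>\<Sum> g i j h\<^sub>i k\<^sub>j\<close> has half-integral weights \<open>\<delta> i / 2\<close> attached to the coordinates, which
  are pairwise distinct modulo the value group. Hence the terms \<open>g i i h\<^sub>i k\<^sub>i\<close> cannot interfere with
  each other, while the terms off the diagonal are of higher degree.\<close>

locale weighted_form = series_field coef \<iota>
  for coef :: "'g::linordered_ab_group_add \<Rightarrow> 'k::field \<Rightarrow> 'f::field" and \<iota> +
  fixes N :: "'i set" and \<delta> :: "'i \<Rightarrow> 'g" and g :: "'i \<Rightarrow> 'i \<Rightarrow> 'k"
  assumes finite_N: "finite N"
    and weights: "i \<in> N \<Longrightarrow> j \<in> N \<Longrightarrow> \<mu> + \<mu> + \<delta> i = \<nu> + \<nu> + \<delta> j \<Longrightarrow> i = j"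
    and off_diagonal: "i \<in> N \<Longrightarrow> j \<in> N \<Longrightarrow> i \<noteq> j \<Longrightarrow> coef \<tau> (g i j) \<noteq> 0 \<Longrightarrow> \<delta> i + \<delta> j < \<tau> + \<tau>"
    and diagonal: "i \<in> N \<Longrightarrow> deg_ge coef (\<delta> i) (g i i)" "i \<in> N \<Longrightarrow> coef (\<delta> i) (g i i) \<noteq> 0"
begin

text \<open>Weights are doubled, 2 \<mu> + \<delta> i in place of \<mu> + \<delta> i / 2, so that no
  halves of group elements occur.\<close>

definition wt_ge :: "'g \<Rightarrow> ('i \<Rightarrow> 'k) \<Rightarrow> bool" where
  "wt_ge \<gamma> h \<longleftrightarrow> (\<forall>i\<in>N. \<forall>\<mu>. coef \<mu> (h i) \<noteq> 0 \<longrightarrow> \<gamma> \<le> \<mu> + \<mu> + \<delta> i)"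

definition form :: "('i \<Rightarrow> 'k) \<Rightarrow> ('i \<Rightarrow> 'k) \<Rightarrow> 'k" where
  "form h k = (\<Sum>i\<in>N. \<Sum>j\<in>N. h i * k j * g i j)"

lemma double_less_iff: "x + x < y + y \<longleftrightarrow> x < (y::'g)"
  by (metis add_strict_mono linorder_neq_iff order_less_asym)

text \<open>Let \<mu>, \<nu>, \<tau> be the lowest degrees of the three factors. Adding \<gamma>
  \<le> 2 \<mu> + \<delta> i, \<gamma> \<le> 2 \<nu> + \<delta> j and \<delta> i + \<delta> j \<le>
  2 \<tau> gives 2 \<gamma> \<le> 2 (\<mu> + \<nu> + \<tau>).\<close>

lemma coef_term:
  assumes i: "i \<in> N" "j \<in> N" and h: "wt_ge \<gamma> h" and k: "wt_ge \<gamma> k"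
  shows "deg_ge coef \<gamma> (h i * k j * g i j)"
    and "coef \<gamma> (h i * k j * g i j) \<noteq> 0 \<Longrightarrow> i = j \<and> (\<exists>\<mu>. \<gamma> = \<mu> + \<mu> + \<delta> i)"
proof -
  have "deg_ge coef \<gamma> (h i * k j * g i j) \<and>
    (coef \<gamma> (h i * k j * g i j) \<noteq> 0 \<longrightarrow> i = j \<and> (\<exists>\<mu>. \<gamma> = \<mu> + \<mu> + \<delta> i))"
  proof (cases "h i = 0 \<or> k j = 0 \<or> g i j = 0")
    case False
    then obtain \<mu> \<nu> \<tau> where
      \<mu>: "coef \<mu> (h i) \<noteq> 0" "deg_ge coef \<mu> (h i)" and
      \<nu>: "coef \<nu> (k j) \<noteq> 0" "deg_ge coef \<nu> (k j)" and
      \<tau>: "coef \<tau> (g i j) \<noteq> 0" "deg_ge coef \<tau> (g i j)"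
      using leading_term by metis
    have deg: "deg_ge coef (\<mu> + \<nu> + \<tau>) (h i * k j * g i j)"
      using deg_ge_mult \<mu>(2) \<nu>(2) \<tau>(2) by blast
    have 1: "\<gamma> \<le> \<mu> + \<mu> + \<delta> i" "\<gamma> \<le> \<nu> + \<nu> + \<delta> j"
      using h k i \<mu>(1) \<nu>(1) by (auto simp: wt_ge_def)
    have dia: "\<tau> = \<delta> i" if "i = j"
      using that diagonal[OF i(1)] \<tau> by (metis deg_ge_coef_nonzero order_antisym)
    have 2: "\<delta> i + \<delta> j \<le> \<tau> + \<tau>"
      using off_diagonal[OF i _ \<tau>(1)] dia by (cases "i = j") auto
    have sum: "(\<mu> + \<mu> + \<delta> i) + (\<nu> + \<nu> + \<delta> j) + (\<tau> + \<tau>) = (\<mu> + \<nu> + \<tau>) + (\<mu> + \<nu> + \<tau>) + (\<delta> i + \<delta> j)"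
      by (simp add: algebra_simps)
    have le: "\<gamma> \<le> \<mu> + \<nu> + \<tau>"
    proof (rule ccontr)
      assume "\<not> \<gamma> \<le> \<mu> + \<nu> + \<tau>"
      then have "(\<mu> + \<nu> + \<tau>) + (\<mu> + \<nu> + \<tau>) + (\<delta> i + \<delta> j) < \<gamma> + \<gamma> + (\<delta> i + \<delta> j)"
        by (simp add: add_strict_mono)
      also have "\<dots> \<le> (\<mu> + \<mu> + \<delta> i) + (\<nu> + \<nu> + \<delta> j) + (\<tau> + \<tau>)"
        by (rule add_mono[OF add_mono[OF 1] 2])
      finally show False by (simp add: sum)
    qed
    \<comment> \<open>Equality in the sum forces equality in each summand, whereas
      \<open>off_diagonal\<close> is strict.\<close>
    have eq: "i = j \<and> \<gamma> = \<mu> + \<mu> + \<delta> i" if "\<gamma> = \<mu> + \<nu> + \<tau>"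
    proof -
      have s: "(\<mu> + \<mu> + \<delta> i) + (\<nu> + \<nu> + \<delta> j) + (\<tau> + \<tau>) = \<gamma> + \<gamma> + (\<delta> i + \<delta> j)"
        by (simp add: sum that)
      have "i = j"
      proof (rule ccontr)
        assume "i \<noteq> j"
        then have "\<gamma> + \<gamma> + (\<delta> i + \<delta> j) < (\<mu> + \<mu> + \<delta> i) + (\<nu> + \<nu> + \<delta> j) + (\<tau> + \<tau>)"
          by (rule add_le_less_mono[OF add_mono[OF 1] off_diagonal[OF i _ \<tau>(1)]])
        with s show False by simp
      qed
      moreover have "\<mu> + \<mu> + \<delta> i \<le> \<gamma>"
      proof (rule ccontr)
        assume "\<not> \<mu> + \<mu> + \<delta> i \<le> \<gamma>"
        then have "\<gamma> < \<mu> + \<mu> + \<delta> i" by simp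
        then have "\<gamma> + \<gamma> + (\<delta> i + \<delta> j) < (\<mu> + \<mu> + \<delta> i) + (\<nu> + \<nu> + \<delta> j) + (\<tau> + \<tau>)"
          by (rule add_less_le_mono[OF add_less_le_mono[OF _ 1(2)] 2])
        with s show False by simp
      qed
      ultimately show ?thesis using 1 by simp
    qed
    show ?thesis
    proof (intro conjI[of "deg_ge _ _ _"] impI)
      show "deg_ge coef \<gamma> (h i * k j * g i j)"
        using deg le unfolding deg_ge_def by (meson order_less_le_trans)
      assume "coef \<gamma> (h i * k j * g i j) \<noteq> 0"
      with deg have "\<mu> + \<nu> + \<tau> \<le> \<gamma>" by (rule deg_ge_coef_nonzero)
      with le have "\<gamma> = \<mu> + \<nu> + \<tau>" by (rule order_antisym)
      from eq[OF this] show "i = j \<and> (\<exists>\<mu>. \<gamma> = \<mu> + \<mu> + \<delta> i)" by blast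
    qed
  qed (auto simp: deg_ge_def)
  then show "deg_ge coef \<gamma> (h i * k j * g i j)"
    "coef \<gamma> (h i * k j * g i j) \<noteq> 0 \<Longrightarrow> i = j \<and> (\<exists>\<mu>. \<gamma> = \<mu> + \<mu> + \<delta> i)" by blast+
qed

text \<open>By \<open>coef_term\<close> only diagonal terms reach degree \<gamma>, and by
  \<open>weights\<close> the class of \<gamma> modulo doubled exponents determines the index, so a
  single term survives. This is the source of rank one.\<close>

lemma coef_form:
  assumes i: "i \<in> N" and \<gamma>: "\<gamma> = \<mu> + \<mu> + \<delta> i" and h: "wt_ge \<gamma> h" and k: "wt_ge \<gamma> k"
  shows "coef \<gamma> (form h k) = coef \<mu> (h i) * coef \<mu> (k i) * coef (\<delta> i) (g i i)"
proof -
  have zero: "coef \<gamma> (h j * k l * g j l) = 0" if "j \<in> N" "l \<in> N" "j \<noteq> i \<or> l \<noteq> i" for j l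
  proof (rule ccontr)
    assume "coef \<gamma> (h j * k l * g j l) \<noteq> 0"
    from coef_term(2)[OF that(1,2) h k this] obtain \<nu> where "j = l" "\<gamma> = \<nu> + \<nu> + \<delta> j" by blast
    with weights[OF that(1) i, of \<nu> \<mu>] \<gamma> that(3) show False by simp
  qed
  have "coef \<gamma> (form h k) = (\<Sum>j\<in>N. \<Sum>l\<in>N. coef \<gamma> (h j * k l * g j l))"
    by (simp add: form_def coef_sum)
  also have "\<dots> = (\<Sum>j\<in>N. if j = i then \<Sum>l\<in>N. if l = i then coef \<gamma> (h i * k i * g i i) else 0 else 0)"
    using zero by (intro sum.cong) (auto intro: sum.cong)
  also have "\<dots> = coef (\<mu> + \<mu> + \<delta> i) (h i * k i * g i i)"
    using i finite_N by (simp add: sum.delta \<gamma>)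
  also have "\<dots> = coef \<mu> (h i) * coef \<mu> (k i) * coef (\<delta> i) (g i i)"
  proof -
    have "deg_ge coef \<mu> (f i)" if "wt_ge \<gamma> f" for f
      unfolding deg_ge_def
    proof (intro allI impI)
      fix \<nu> assume "\<nu> < \<mu>"
      then have "\<nu> + \<nu> + \<delta> i < \<gamma>" by (simp add: \<gamma> double_less_iff)
      then show "coef \<nu> (f i) = 0" using that i unfolding wt_ge_def by (meson not_le)
    qed
    then show ?thesis
      using deg_ge_mult diagonal(1)[OF i] h k by metis
  qed
  finally show ?thesis .
qed

text \<open>Takes the minimum of the doubled weights over the finitely many nonzero coordinates of
  members of \<open>H\<close>; it has the shape of \<gamma> required by
  \<open>coef_form\<close>.\<close>

lemma leading_weight:
  assumes "finite H" "h \<in> H" "j \<in> N" "h j \<noteq> 0"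
  obtains i \<mu> h0 where "i \<in> N" "h0 \<in> H" "coef \<mu> (h0 i) \<noteq> 0" "\<And>h. h \<in> H \<Longrightarrow> wt_ge (\<mu> + \<mu> + \<delta> i) h"
proof -
  define lead where "lead c = (SOME \<mu>. coef \<mu> c \<noteq> 0 \<and> deg_ge coef \<mu> c)" for c
  have lead: "coef (lead c) c \<noteq> 0" "deg_ge coef (lead c) c" if "c \<noteq> 0" for c
    using someI_ex[OF leading_term[OF that]] by (simp_all add: lead_def)
  define P where "P = {(h, i). h \<in> H \<and> i \<in> N \<and> h i \<noteq> 0}"
  define w where "w = (\<lambda>(h :: 'i \<Rightarrow> 'k, i). lead (h i) + lead (h i) + \<delta> i)"
  have "P \<subseteq> H \<times> N" by (auto simp: P_def)
  then have "finite P" using assms(1) finite_N by (auto intro: finite_subset)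
  moreover have "P \<noteq> {}" using assms by (auto simp: P_def)
  ultimately have Min: "Min (w ` P) \<in> w ` P" "\<And>p. p \<in> P \<Longrightarrow> Min (w ` P) \<le> w p" by simp_all
  then obtain h0 i where p: "(h0, i) \<in> P" "Min (w ` P) = w (h0, i)" by auto
  show ?thesis
  proof (rule that[of i h0 "lead (h0 i)"])
    show "i \<in> N" "h0 \<in> H" "coef (lead (h0 i)) (h0 i) \<noteq> 0"
      using p lead by (auto simp: P_def)
    fix h assume h: "h \<in> H"
    show "wt_ge (lead (h0 i) + lead (h0 i) + \<delta> i) h"
      unfolding wt_ge_def
    proof (intro ballI allI impI)
      fix j \<mu> assume j: "j \<in> N" "coef \<mu> (h j) \<noteq> 0"
      then have "h j \<noteq> 0" by auto
      with j h have "(h, j) \<in> P" by (simp add: P_def)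
      from Min(2)[OF this] have "lead (h0 i) + lead (h0 i) + \<delta> i \<le> lead (h j) + lead (h j) + \<delta> j"
        unfolding p(2) by (simp add: w_def)
      also have "lead (h j) \<le> \<mu>" using lead(2)[OF \<open>h j \<noteq> 0\<close>] j(2) by (rule deg_ge_coef_nonzero)
      then have "lead (h j) + lead (h j) + \<delta> j \<le> \<mu> + \<mu> + \<delta> j" by (simp add: add_mono)
      finally show "lead (h0 i) + lead (h0 i) + \<delta> i \<le> \<mu> + \<mu> + \<delta> j" .
    qed
  qed
qed

text \<open>No cancellation: at the lowest weight of a nonzero \<open>h\<close>, the coefficient of
  \<open>form h h\<close> is a nonzero square times a nonzero scalar.\<close>

lemma wt_ge_if_deg_ge:
  assumes "deg_ge coef \<gamma> (form h h)"
  shows "wt_ge \<gamma> h"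
proof (cases "\<exists>j\<in>N. h j \<noteq> 0")
  case True
  then obtain j where j: "j \<in> N" "h j \<noteq> 0" by blast
  obtain i \<mu> where i: "i \<in> N" "coef \<mu> (h i) \<noteq> 0" "wt_ge (\<mu> + \<mu> + \<delta> i) h"
    by (rule leading_weight[of "{h}" h j]) (use j in auto)
  have "coef (\<mu> + \<mu> + \<delta> i) (form h h) \<noteq> 0"
    using coef_form[OF i(1) refl i(3) i(3)] i(2) diagonal(2)[OF i(1)] by simp
  with assms have "\<gamma> \<le> \<mu> + \<mu> + \<delta> i" by (rule deg_ge_coef_nonzero)
  with i(3) show ?thesis by (auto simp: wt_ge_def intro: order_trans)
next
  case False
  then show ?thesis by (auto simp: wt_ge_def)
qed

end

context weighted_form
begin

text \<open>\<open>T\<close> acts as a trace and \<open>xs\<close> as coordinates. In the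
  applications \<open>T 1\<close> is 1, so the last conclusion yields \<open>l 1 = 0\<close>
  whenever the lowest weight \<gamma> on \<open>S\<close> is nonzero.\<close>

lemma exists_rank_one:
  fixes B :: "('k, 'b::ring_1) alg_inv"
  assumes T: "\<And>x y. T (x + y) = T x + T y" "\<And>c x. T (scl B c x) = c * T x"
    and xs: "\<And>x y i. xs (x + y) i = xs x i + xs y i" "\<And>c x i. xs (scl B c x) i = c * xs x i"
    and form: "\<And>h k. T (invol B h * k) = form (xs h) (xs k)"
    and S: "finite S" "h \<in> S" "j \<in> N" "xs h j \<noteq> 0"
  obtains \<gamma> l m where "rank_one_on \<iota> B S l m" "\<And>h. h \<in> S \<Longrightarrow> wt_ge \<gamma> (xs h)"
    "coef \<gamma> (T 1) = 0 \<Longrightarrow> l 1 = 0"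
proof (rule leading_weight[of "xs ` S" "xs h" j])
  show "finite (xs ` S)" "xs h \<in> xs ` S" "j \<in> N" "xs h j \<noteq> 0" using S by auto
next
  fix i \<mu> h0
  assume i: "i \<in> N" and "h0 \<in> xs ` S" "coef \<mu> (h0 i) \<noteq> 0"
    and wt: "\<And>h. h \<in> xs ` S \<Longrightarrow> wt_ge (\<mu> + \<mu> + \<delta> i) h"
  then have ex: "\<exists>k\<in>S. coef \<mu> (xs k i) \<noteq> 0" by auto
  define c where "c = coef (\<delta> i) (g i i)"
  have c: "c \<noteq> 0" using diagonal(2)[OF i] by (simp add: c_def)
  \<comment> \<open>Division by the leading coefficient of \<open>g i i\<close> removes the constant
    from \<open>coef_form\<close>.\<close>
  define l where "l y = coef (\<mu> + \<mu> + \<delta> i) (T y) / c" for y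
  define m where "m y = coef \<mu> (xs y i)" for y
  have "base_linear \<iota> (scl B) l" "base_linear \<iota> (scl B) m"
    by (simp_all add: base_linear_def l_def m_def T xs coef_add coef_scale add_divide_distrib)
  moreover have "l (invol B y * z) = m y * m z" if "y \<in> S" "z \<in> S" for y z
    using coef_form[OF i refl wt wt, of "xs y" "xs z"] that c by (simp add: l_def m_def form c_def)
  ultimately have "rank_one_on \<iota> B S l m"
    using ex by (simp add: rank_one_on_def m_def)
  then show thesis
    by (rule that) (use wt in \<open>auto simp: l_def\<close>)
qed

end

section \<open>The second factor \<open>Ad\<close> of a binary form\<close>

abbreviation entry :: "('k::field, 'n::finite) sqmat \<Rightarrow> 'n \<Rightarrow> 'n \<Rightarrow> 'k" where
  "entry M i j \<equiv> vec_of_sqmat M $ i $ j"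

lemma entry_simps:
  fixes M N :: "('k::field, 'n::finite) sqmat"
  shows "entry (M + N) i j = entry M i j + entry N i j" "entry (sqmat_scl c M) i j = c * entry M i j"
    "entry 1 i j = (if i = j then 1 else 0)" "entry 0 i j = 0"
    "entry (M * N) i j = (\<Sum>k\<in>UNIV. entry M i k * entry N k j)"
  by (simp_all add: plus_sqmat.rep_eq sqmat_scl.rep_eq one_sqmat.rep_eq zero_sqmat.rep_eq
      times_sqmat.rep_eq mat_def matrix_matrix_mult_def)

lemma sqmat_eqI: "(\<And>i j. entry M i j = entry N i j) \<Longrightarrow> M = N"
  by (metis vec_eq_iff vec_of_sqmat_inject)

definition pfister_coeff :: "'k::field \<Rightarrow> 2 \<Rightarrow> 'k" where
  "pfister_coeff x i = (if i = 1 then 1 else - x)"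

lemma two_neq_one [simp]: "(2::2) \<noteq> 1" "(1::2) \<noteq> 2"
  by simp_all

lemma polar_pfister_form:
  "polar_form (pfister_form x) v w = 2 * (\<Sum>k\<in>UNIV. pfister_coeff x k * v $ k * w $ k)"
  by (simp add: polar_form_def pfister_form_def pfister_coeff_def sum_2 algebra_simps power2_eq_square)

text \<open>With D the diagonal matrix of the form, the adjoint is D^-1 M^T D. Uniqueness follows by
  testing on unit vectors, which isolates one entry after cancelling the factor 2 of the polar
  form.\<close>

lemma entry_adjoint_pfister:
  fixes x :: "'k::field"
  assumes two: "(2::'k) \<noteq> 0" and x: "x \<noteq> 0"
  shows "entry (adjoint_involution (pfister_form x) M) i j =
    pfister_coeff x j * entry M j i / pfister_coeff x i"
proof -
  let ?d = "pfister_coeff x" and ?p = "polar_form (pfister_form x)"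
  have d: "?d k \<noteq> 0" for k using x by (simp add: pfister_coeff_def)
  define A where "A = sqmat_of_vec (\<chi> i j. ?d j * entry M j i / ?d i)"
  have A: "entry A i j = ?d j * entry M j i / ?d i" for i j
    by (simp add: A_def sqmat_of_vec_inverse)
  have apply_nth: "sqmat_apply L v $ i = (\<Sum>k\<in>UNIV. entry L i k * v $ k)" for L v i
    by (simp add: sqmat_apply.rep_eq matrix_vector_mult_def)
  have "?p v (sqmat_apply M w) = ?p (sqmat_apply A v) w" for v w
    using d by (simp add: polar_pfister_form apply_nth A sum_2 field_simps)
  moreover have "L = A" if L: "\<forall>v w. ?p v (sqmat_apply M w) = ?p (sqmat_apply L v) w" for L
  proof (rule sqmat_eqI)
    fix i j
    have axis_nth: "axis j (1 :: 'k) $ k = (if k = j then 1 else 0)" for j k :: 2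
      by (simp add: axis_def)
    have "sqmat_apply K (axis j 1) $ k = entry K k j" for K :: "('k, 2) sqmat" and j k
      by (simp add: apply_nth axis_nth if_distrib cong: if_cong)
    with L[rule_format, of "axis j 1" "axis i 1"] two have "?d j * entry M j i = ?d i * entry L i j"
      by (simp add: polar_pfister_form axis_nth if_distrib if_distribR mult.commute cong: if_cong)
    then show "entry L i j = entry A i j" using d by (simp add: A field_simps)
  qed
  ultimately have "adjoint_involution (pfister_form x) M = A"
    unfolding adjoint_involution_def by (intro the_equality) blast+
  then show ?thesis by (simp add: A)
qed

lemma is_involution_Ad:
  fixes x :: "'k::field"
  assumes "(2::'k) \<noteq> 0" "x \<noteq> 0"
  shows "is_involution (Ad (pfister_form x))"
proof -
  note adj = entry_adjoint_pfister[OF assms]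
  have d: "pfister_coeff x k \<noteq> 0" for k using assms by (simp add: pfister_coeff_def)
  have "vector_space (sqmat_scl :: 'k \<Rightarrow> ('k, 2) sqmat \<Rightarrow> _)"
    by unfold_locales (rule sqmat_eqI, simp add: entry_simps algebra_simps)+
  moreover from this have "Vector_Spaces.linear sqmat_scl sqmat_scl (adjoint_involution (pfister_form x))"
    unfolding Vector_Spaces.linear_iff
    by (auto intro!: sqmat_eqI simp: entry_simps adj algebra_simps add_divide_distrib)
  ultimately show ?thesis
    using d
    by (auto simp: is_involution_def Ad_def entry_simps adj sum_2 field_simps
        intro!: sqmat_eqI)
qed

section \<open>Columns of matrices over F((x)) as weighted forms\<close>

lemma fls_X_mult_X_inv: "fls_X * fls_X_inv = (1 :: 'f::field fls)"
  by (simp add: fls_X_times_conv_shift fls_X_inv_conv_shift_1)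

lemma fls_inverse_X_eq: "inverse fls_X = (fls_X_inv :: 'f::field fls)"
  by (rule inverse_unique) (rule fls_X_mult_X_inv)

text \<open>Column \<open>j\<close> of a matrix with the form \<open>(M, N) \<mapsto> (\<sigma>(M) N)\<^bsub>j j\<^esub>\<close>, which is \<open>\<langle>1, -x\<rangle>\<close> for \<open>j = 1\<close>
  and \<open>\<langle>-1/x, 1\<rangle>\<close> for \<open>j = 2\<close>.\<close>

definition column_weight :: "2 \<Rightarrow> 2 \<Rightarrow> int" where
  "column_weight j i = (if i = j then 0 else if j = 1 then 1 else - 1)"

definition column_form :: "2 \<Rightarrow> 2 \<Rightarrow> 2 \<Rightarrow> 'f::field fls" where
  "column_form j i k = (if i \<noteq> k then 0 else if i = j then 1 else if j = 1 then - fls_X else - fls_X_inv)"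

interpretation column: weighted_form "\<lambda>n c. c $$ n" fls_const UNIV "column_weight j" "column_form j"
  for j
proof
  \<comment> \<open>The two weights of a column are 0 and 1, or 0 and -1, hence of different
    parity.\<close>
  show "i = k" if "\<mu> + \<mu> + column_weight j i = \<nu> + \<nu> + column_weight j k" for i k \<mu> \<nu>
    using that exhaust_2[of i] exhaust_2[of j] exhaust_2[of k]
    by (auto simp: column_weight_def; presburger)
qed (auto simp: column_form_def column_weight_def deg_ge_def)

lemma Ad_column:
  assumes "(2::'f::field) \<noteq> 0"
  shows "entry (invol (Ad (pfister_form (fls_X :: 'f fls))) M * N) j j =
    column.form j (\<lambda>i. entry M i j) (\<lambda>i. entry N i j)"
proof -
  have two: "(2 :: 'f fls) \<noteq> 0" using assms by (metis fls_const_numeral fls_const_eq_0_iff)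
  show ?thesis
    using exhaust_2[of j]
    by (auto simp: column.form_def Ad_def entry_simps entry_adjoint_pfister[OF two] sum_2
        column_form_def pfister_coeff_def divide_inverse fls_inverse_X_eq fls_X_mult_X_inv mult_ac)
qed

text \<open>This is the Iwahori order: matrices over F[[x]] whose entry (1, 2) is divisible by
  x.\<close>

definition Ad_order :: "('f::field fls, 2) sqmat set" where
  "Ad_order = {M. \<forall>j. column.wt_ge j 0 (\<lambda>i. entry M i j)}"

text \<open>The entry (1, 1) of a product also receives M12 N21, which is divisible by x and so
  leaves the constant term alone.\<close>

lemma residue_Ad:
  assumes "(2::'f::field) \<noteq> 0"
  shows "residue_on fls_const (Ad (pfister_form (fls_X :: 'f fls))) Ad_order (\<lambda>M. entry M 1 1 $$ 0)"
proof -
  have two: "(2 :: 'f fls) \<noteq> 0" using assms by (metis fls_const_numeral fls_const_eq_0_iff)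
  have mult: "entry (M * N) 1 1 $$ 0 = entry M 1 1 $$ 0 * entry N 1 1 $$ 0"
    if M: "M \<in> Ad_order" and N: "N \<in> Ad_order" for M N :: "('f fls, 2) sqmat"
  proof -
    have wt: "0 \<le> \<mu> + \<mu> + column_weight j i" if "L \<in> Ad_order" "entry L i j $$ \<mu> \<noteq> 0"
      for L :: "('f fls, 2) sqmat" and i j \<mu>
      using that by (auto simp: Ad_order_def column.wt_ge_def)
    have "entry L 1 1 $$ \<mu> = 0" "entry L 2 1 $$ \<mu> = 0" if "L \<in> Ad_order" "\<mu> < 0"
      for L :: "('f fls, 2) sqmat" and \<mu>
      using wt[OF that(1), of 1 1 \<mu>] wt[OF that(1), of 2 1 \<mu>] that(2) by (auto simp: column_weight_def)
    \<comment> \<open>Here the weight condition reads 0 \<le> 2 \<mu> - 1, which for an integer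
      means 1 \<le> \<mu>.\<close>
    moreover have "entry L 1 2 $$ \<mu> = 0" if "L \<in> Ad_order" "\<mu> < 1"
      for L :: "('f fls, 2) sqmat" and \<mu>
      using wt[OF that(1), of 1 2 \<mu>] that(2) by (auto simp: column_weight_def)
    ultimately show ?thesis
      using M N fls_mult_nth_le[of 0 "entry M 1 1" 0 "entry N 1 1" 0]
        fls_mult_nth_le[of 1 "entry M 1 2" 0 "entry N 2 1" 0]
      by (simp add: entry_simps sum_2)
  qed
  show ?thesis
    unfolding residue_on_def base_linear_def
    using mult
    by (simp add: Ad_def entry_simps entry_adjoint_pfister[OF two] pfister_coeff_def)
qed

text \<open>One column suffices: choose \<open>j\<close> so that column \<open>j\<close> of some
  member is nonzero, respectively fails to have weight at least 0. In the second case the lowest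
  weight of column \<open>j\<close> is not 0, and the entry (j, j) of 1 has no coefficient
  there.\<close>

lemma Ad_rank_one:
  fixes S :: "('f::field fls, 2) sqmat set"
  assumes two: "(2::'f) \<noteq> 0" and S: "finite S"
  shows "\<exists>M\<in>S. M \<noteq> 0 \<Longrightarrow> \<exists>l m. rank_one_on fls_const (Ad (pfister_form fls_X)) S l m"
    and "\<not> S \<subseteq> Ad_order \<Longrightarrow> \<exists>l m. rank_one_on fls_const (Ad (pfister_form fls_X)) S l m \<and> l 1 = 0"
proof -
  have rank_one: thesis
    if "M \<in> S" "entry M i j \<noteq> 0"
      "\<And>\<gamma> l m. rank_one_on fls_const (Ad (pfister_form fls_X)) S l m \<Longrightarrow>
        (\<And>M. M \<in> S \<Longrightarrow> column.wt_ge j \<gamma> (\<lambda>i. entry M i j)) \<Longrightarrow> (\<gamma> \<noteq> 0 \<Longrightarrow> l 1 = 0) \<Longrightarrow> thesis"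
    for M i j thesis
  proof (rule column.exists_rank_one[of "\<lambda>M. entry M j j" "Ad (pfister_form fls_X)" "\<lambda>M i. entry M i j" j S M i])
    fix \<gamma> l m
    assume "rank_one_on fls_const (Ad (pfister_form fls_X)) S l m"
      "\<And>M. M \<in> S \<Longrightarrow> column.wt_ge j \<gamma> (\<lambda>i. entry M i j)" "entry 1 j j $$ \<gamma> = 0 \<Longrightarrow> l 1 = 0"
    then show thesis by (rule that(3)) (auto simp: entry_simps)
  next
    show "entry (invol (Ad (pfister_form fls_X)) L * N) j j =
        column.form j (\<lambda>i. entry L i j) (\<lambda>i. entry N i j)" for L N :: "('f fls, 2) sqmat"
      by (rule Ad_column[OF two])
  qed (use that(1,2) S in \<open>simp_all add: Ad_def entry_simps\<close>)
  show "\<exists>l m. rank_one_on fls_const (Ad (pfister_form fls_X)) S l m" if nz: "\<exists>M\<in>S. M \<noteq> 0"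
  proof -
    obtain M where M: "M \<in> S" "M \<noteq> 0" using nz by blast
    then obtain i j where "entry M i j \<noteq> 0"
      by (metis sqmat_eqI entry_simps(4))
    with M(1) show ?thesis by (rule rank_one) blast
  qed
  show "\<exists>l m. rank_one_on fls_const (Ad (pfister_form fls_X)) S l m \<and> l 1 = 0" if nv: "\<not> S \<subseteq> Ad_order"
  proof -
    obtain M j where M: "M \<in> S" "\<not> column.wt_ge j 0 (\<lambda>i. entry M i j)"
      using nv by (auto simp: Ad_order_def)
    have "\<exists>i. entry M i j \<noteq> 0"
      by (rule ccontr) (use M(2) in \<open>simp add: column.wt_ge_def\<close>)
    then obtain i where "entry M i j \<noteq> 0" by blast
    from M(1) this show ?thesis
    proof (rule rank_one)
      fix \<gamma> l m
      assume "rank_one_on fls_const (Ad (pfister_form fls_X)) S l m"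
        "\<And>M. M \<in> S \<Longrightarrow> column.wt_ge j \<gamma> (\<lambda>i. entry M i j)" "\<gamma> \<noteq> 0 \<Longrightarrow> l 1 = 0"
      with M show ?thesis by metis
    qed
  qed
qed

section \<open>The second factor a quaternion algebra\<close>

text \<open>An algebra with a basis that is orthogonal for the trace form, i.e. for the coordinate
  \<open>xs _ o\<close> of the product, and whose elements square to scalars of distinct weights.\<close>

locale orthogonal_basis = diag: weighted_form coef \<iota> N \<delta> "\<lambda>i j. if i = j then d i else 0"
  for coef :: "'g::linordered_ab_group_add \<Rightarrow> 'k::field \<Rightarrow> 'f::field" and \<iota>
    and N :: "'i set" and \<delta> :: "'i \<Rightarrow> 'g" and d :: "'i \<Rightarrow> 'k" +
  fixes B :: "('k, 'b::ring_1) alg_inv" and e :: "'i \<Rightarrow> 'b" and xs :: "'b \<Rightarrow> 'i \<Rightarrow> 'k" and z :: 'i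
  assumes algebra_B: "algebra_over (scl B)" and invol_B: "is_involution B"
    and expansion: "h = (\<Sum>i\<in>N. scl B (xs h i) (e i))"
    and xs_add: "xs (h + k) i = xs h i + xs k i" and xs_scale: "xs (scl B c h) i = c * xs h i"
    and orthogonal: "i \<in> N \<Longrightarrow> j \<in> N \<Longrightarrow> xs (e i * e j) z = (if i = j then d i else 0)"
    and square: "i \<in> N \<Longrightarrow> e i * e i = scl B (d i) 1"
    and one: "z \<in> N" "e z = 1" "d z = 1" "\<delta> z = 0" "xs 1 i = (if i = z then 1 else 0)"
begin

lemma
  shows mult_scale: "scl B c h * k = scl B c (h * k)" "h * scl B c k = scl B c (h * k)"
    and invol_mult: "invol B (h * k) = invol B k * invol B h"
    and invol_one: "invol B 1 = 1"
    and linear_invol: "Vector_Spaces.linear (scl B) (scl B) (invol B)"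
proof -
  show "scl B c h * k = scl B c (h * k)" "h * scl B c k = scl B c (h * k)"
    using algebra_B unfolding algebra_over_def by metis+
  show *: "invol B (h * k) = invol B k * invol B h" for h k
    using invol_B by (simp add: is_involution_def)
  have "invol B (invol B h) = h" for h
    using invol_B by (simp add: is_involution_def)
  then show "invol B 1 = 1" using *[of "invol B 1" 1] by simp
  show "Vector_Spaces.linear (scl B) (scl B) (invol B)"
    using invol_B by (simp add: is_involution_def)
qed

sublocale invol: Vector_Spaces.linear "scl B" "scl B" "invol B" by (rule linear_invol)

lemma xs_sum: "xs (\<Sum>i\<in>I. f i) j = (\<Sum>i\<in>I. xs (f i) j)"
  by (rule additive.sum) (simp add: additive_def xs_add)

lemma diag_form: "diag.form f f' = (\<Sum>i\<in>N. f i * f' i * d i)"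
  unfolding diag.form_def by (simp add: if_distrib diag.finite_N cong: if_cong)

lemma trace_mult: "xs (h * k) z = diag.form (xs h) (xs k)"
proof -
  have "h * k = (\<Sum>i\<in>N. scl B (xs h i) (e i)) * (\<Sum>j\<in>N. scl B (xs k j) (e j))"
    using expansion by metis
  then show ?thesis
    by (simp add: sum_product mult_scale xs_sum xs_scale orthogonal diag.form_def mult_ac cong: sum.cong)
qed

text \<open>Gram matrix of the trace form twisted by the involution; see
  \<open>trace_invol_mult\<close>.\<close>

definition g :: "'i \<Rightarrow> 'i \<Rightarrow> 'k" where
  "g i j = xs (invol B (e i)) j * d j"

text \<open>Since \<open>\<sigma>(e\<^sub>i)\<^sup>2 = d\<^sub>i\<close>, the involution moves \<open>e\<^sub>i\<close> to a multiple of \<open>e\<^sub>i\<close> plus terms of higher weight.\<close>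

lemma wt_invol: "i \<in> N \<Longrightarrow> diag.wt_ge (\<delta> i) (xs (invol B (e i)))"
  and leading_invol: "i \<in> N \<Longrightarrow> coef 0 (xs (invol B (e i)) i) \<noteq> 0"
proof -
  assume i: "i \<in> N"
  let ?y = "xs (invol B (e i))"
  have "invol B (e i) * invol B (e i) = scl B (d i) 1"
    by (simp add: square[OF i] invol.scale invol_one flip: invol_mult)
  then have form: "diag.form ?y ?y = d i"
    by (simp add: xs_scale one flip: trace_mult)
  show wt: "diag.wt_ge (\<delta> i) ?y"
    by (rule diag.wt_ge_if_deg_ge) (use diag.diagonal(1)[OF i] in \<open>simp add: form\<close>)
  \<comment> \<open>With \<mu> = 0, \<open>coef_form\<close> equates the leading coefficient of
    \<open>d i\<close> with its product by the square of this coefficient.\<close>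
  show "coef 0 (?y i) \<noteq> 0"
    using diag.coef_form[OF i _ wt wt, of 0] diag.diagonal(2)[OF i] by (auto simp: form)
qed

sublocale weighted_form coef \<iota> N \<delta> g
proof
  show "finite N" by (rule diag.finite_N)
next
  fix i j \<mu> \<nu> assume "i \<in> N" "j \<in> N" "\<mu> + \<mu> + \<delta> i = \<nu> + \<nu> + \<delta> j"
  then show "i = j" by (rule diag.weights)
next
  fix i j \<tau> assume i: "i \<in> N" and j: "j \<in> N" and ij: "i \<noteq> j" and nz: "coef \<tau> (g i j) \<noteq> 0"
  then have "xs (invol B (e i)) j \<noteq> 0" by (auto simp: g_def)
  then obtain \<nu> where \<nu>: "coef \<nu> (xs (invol B (e i)) j) \<noteq> 0" "deg_ge coef \<nu> (xs (invol B (e i)) j)"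
    using diag.leading_term by blast
  have "deg_ge coef (\<nu> + \<delta> j) (g i j)"
    using diag.deg_ge_mult[OF \<nu>(2)] diag.diagonal(1)[OF j] by (simp add: g_def)
  then have "\<nu> + \<delta> j \<le> \<tau>" using nz by (rule diag.deg_ge_coef_nonzero)
  then have "(\<nu> + \<delta> j) + (\<nu> + \<delta> j) \<le> \<tau> + \<tau>" by (intro add_mono)
  moreover have "\<delta> i \<le> \<nu> + \<nu> + \<delta> j"
    using wt_invol[OF i] j \<nu>(1) by (auto simp: diag.wt_ge_def)
  \<comment> \<open>Distinct indices cannot have equal weights, so the previous inequality is
    strict; adding \<delta> j then gives the off-diagonal bound.\<close>
  moreover have "\<delta> i \<noteq> \<nu> + \<nu> + \<delta> j"
    using diag.weights[OF i j, of 0 \<nu>] ij by auto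
  ultimately have "\<delta> i + \<delta> j < (\<nu> + \<nu> + \<delta> j) + \<delta> j" "(\<nu> + \<nu> + \<delta> j) + \<delta> j \<le> \<tau> + \<tau>"
    by (simp_all add: algebra_simps)
  then show "\<delta> i + \<delta> j < \<tau> + \<tau>" by (rule order_less_le_trans)
next
  fix i assume i: "i \<in> N"
  have "0 \<le> \<mu>" if "coef \<mu> (xs (invol B (e i)) i) \<noteq> 0" for \<mu>
    using wt_invol[OF i] i that by (auto simp: diag.wt_ge_def)
  then have "deg_ge coef 0 (xs (invol B (e i)) i)"
    by (auto simp: deg_ge_def not_le[symmetric])
  from diag.deg_ge_mult[OF this, of "\<delta> i" "d i"]
  show "deg_ge coef (\<delta> i) (g i i)" "coef (\<delta> i) (g i i) \<noteq> 0"
    using diag.diagonal[OF i] leading_invol[OF i] by (simp_all add: g_def)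
qed

lemma trace_invol_mult: "xs (invol B h * k) z = form (xs h) (xs k)"
proof -
  have "xs (invol B h) j = (\<Sum>i\<in>N. xs h i * xs (invol B (e i)) j)" for j
  proof -
    have "invol B h = (\<Sum>i\<in>N. scl B (xs h i) (invol B (e i)))"
      by (subst expansion[of h]) (simp add: invol.sum invol.scale)
    then show ?thesis by (simp add: xs_sum xs_scale)
  qed
  then have "xs (invol B h * k) z = (\<Sum>j\<in>N. \<Sum>i\<in>N. xs h i * xs (invol B (e i)) j * xs k j * d j)"
    by (simp add: trace_mult diag_form sum_distrib_right)
  also have "\<dots> = form (xs h) (xs k)"
    by (subst sum.swap) (simp add: form_def g_def mult_ac)
  finally show ?thesis .
qed

definition order :: "'b set" where
  "order = {h. diag.wt_ge 0 (xs h)}"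

text \<open>Multiplicativity is \<open>coef_form\<close> for the diagonal form at the index
  \<open>z\<close> of weight 0. Invariance under the involution is the same formula for the twisted
  form, with second argument 1.\<close>

lemma residue_order: "residue_on \<iota> B order (\<lambda>h. coef 0 (xs h z))"
proof -
  have wt_one: "diag.wt_ge 0 (xs 1)"
    by (auto simp: diag.wt_ge_def one diag.coef_one)
  have "coef 0 (xs (h * k) z) = coef 0 (xs h z) * coef 0 (xs k z)"
    if "diag.wt_ge 0 (xs h)" "diag.wt_ge 0 (xs k)" for h k
    using diag.coef_form[OF one(1) _ that, of 0] by (simp add: one diag.coef_one trace_mult)
  moreover have "coef 0 (xs (invol B h) z) = coef 0 (xs h z)" if "diag.wt_ge 0 (xs h)" for h
    using coef_form[OF one(1) _ that wt_one, of 0] trace_invol_mult[of h 1]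
    by (simp add: one diag.coef_one g_def invol_one)
  ultimately show ?thesis
    by (simp add: residue_on_def base_linear_def order_def xs_add xs_scale diag.coef_add
        diag.coef_scale one diag.coef_one)
qed

text \<open>If a member of \<open>S\<close> lies outside \<open>order\<close>, the lowest weight on
  \<open>S\<close> cannot be 0, while the trace of 1 is concentrated in degree 0.\<close>

lemma order_rank_one:
  assumes S: "finite S"
  shows "\<exists>h\<in>S. h \<noteq> 0 \<Longrightarrow> \<exists>l m. rank_one_on \<iota> B S l m"
    and "\<not> S \<subseteq> order \<Longrightarrow> \<exists>l m. rank_one_on \<iota> B S l m \<and> l 1 = 0"
proof -
  have rank_one: thesis
    if "h \<in> S" "i \<in> N" "xs h i \<noteq> 0"
      "\<And>\<gamma> l m. rank_one_on \<iota> B S l m \<Longrightarrow> (\<And>h. h \<in> S \<Longrightarrow> diag.wt_ge \<gamma> (xs h)) \<Longrightarrow>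
        (\<gamma> \<noteq> 0 \<Longrightarrow> l 1 = 0) \<Longrightarrow> thesis"
    for h i thesis
  proof (rule exists_rank_one[of "\<lambda>h. xs h z" B xs S h i])
    fix \<gamma> l m
    assume "rank_one_on \<iota> B S l m" "\<And>h. h \<in> S \<Longrightarrow> diag.wt_ge \<gamma> (xs h)" "coef \<gamma> (xs 1 z) = 0 \<Longrightarrow> l 1 = 0"
    then show thesis by (rule that(4)) (auto simp: one diag.coef_one)
  qed (use that(1-3) S in \<open>simp_all add: xs_add xs_scale trace_invol_mult\<close>)
  show "\<exists>l m. rank_one_on \<iota> B S l m" if nz: "\<exists>h\<in>S. h \<noteq> 0"
  proof -
    obtain h where h: "h \<in> S" "h \<noteq> 0" using nz by blast
    have "\<exists>i\<in>N. xs h i \<noteq> 0"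
    proof (rule ccontr)
      assume "\<not> (\<exists>i\<in>N. xs h i \<noteq> 0)"
      then have "(\<Sum>i\<in>N. scl B (xs h i) (e i)) = 0"
        by (simp add: invol.vs1.scale_zero_left)
      with expansion[of h] h(2) show False by simp
    qed
    then obtain i where "i \<in> N" "xs h i \<noteq> 0" by blast
    with h(1) show ?thesis by (rule rank_one) blast
  qed
  show "\<exists>l m. rank_one_on \<iota> B S l m \<and> l 1 = 0" if nv: "\<not> S \<subseteq> order"
  proof -
    obtain h where h: "h \<in> S" "\<not> diag.wt_ge 0 (xs h)"
      using nv by (auto simp: order_def)
    have "\<exists>i\<in>N. xs h i \<noteq> 0"
      by (rule ccontr) (use h(2) in \<open>simp add: diag.wt_ge_def\<close>)
    then obtain i where "i \<in> N" "xs h i \<noteq> 0" by blast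
    from h(1) this show ?thesis
    proof (rule rank_one)
      fix \<gamma> l m
      assume "rank_one_on \<iota> B S l m" "\<And>h. h \<in> S \<Longrightarrow> diag.wt_ge \<gamma> (xs h)" "\<gamma> \<noteq> 0 \<Longrightarrow> l 1 = 0"
      with h show ?thesis by metis
    qed
  qed
qed

end

section \<open>The quaternion algebra (x, y) over F((x))((y))\<close>

abbreviation coef2 :: "int \<times> int \<Rightarrow> 'f::field fls fls \<Rightarrow> 'f" where
  "coef2 \<equiv> \<lambda>(n, m) c. fls_nth (fls_nth c n) m"

lemma series_field2: "series_field (coef2 :: _ \<Rightarrow> 'f::field fls fls \<Rightarrow> 'f) emb2"
  using series_field_fls[OF fls_series.series_field_axioms] by (simp add: emb2_def[abs_def])

definition quat_basis :: "'h::ring_1 \<Rightarrow> 'h \<Rightarrow> bool \<times> bool \<Rightarrow> 'h" where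
  "quat_basis u v = (\<lambda>(p, q). (if p then u else 1) * (if q then v else 1))"

definition quat_coord :: "('k::field \<Rightarrow> 'h::ring_1 \<Rightarrow> 'h) \<Rightarrow> 'h \<Rightarrow> 'h \<Rightarrow> 'h \<Rightarrow> bool \<times> bool \<Rightarrow> 'k" where
  "quat_coord s u v h = (case inv (quat_comb s u v) h of (c0, c1, c2, c3) \<Rightarrow>
     (\<lambda>(p, q). if p then if q then c3 else c1 else if q then c2 else c0))"

definition quat_square :: "'k::field \<Rightarrow> 'k \<Rightarrow> bool \<times> bool \<Rightarrow> 'k" where
  "quat_square a b = (\<lambda>(p, q). (if p then a else 1) * (if q then b else 1) * (if p \<and> q then - 1 else 1))"

text \<open>The components are swapped because exponents list the power of y first, while
  \<open>u\<close> squares to x and \<open>v\<close> to y.\<close>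

definition quat_weight :: "bool \<times> bool \<Rightarrow> int \<times> int" where
  "quat_weight = (\<lambda>(p, q). (of_bool q, of_bool p))"

text \<open>The four weights represent the four classes of pairs of integers modulo 2, so parity
  separates them.\<close>

lemma weighted_form_quat:
  "weighted_form (coef2 :: _ \<Rightarrow> 'f::field fls fls \<Rightarrow> 'f) emb2 UNIV quat_weight
    (\<lambda>i j. if i = j then quat_square x2 y2 i else 0)"
proof -
  interpret series_field "coef2 :: _ \<Rightarrow> 'f fls fls \<Rightarrow> 'f" emb2 by (rule series_field2)
  have one: "deg_ge (coef2 :: _ \<Rightarrow> 'f fls fls \<Rightarrow> 'f) (0, 0) 1 \<and> coef2 (0, 0) (1 :: 'f fls fls) = 1"
    by (auto simp: deg_ge_def)
  have x: "deg_ge coef2 (0, 1) (x2 :: 'f fls fls) \<and> coef2 (0, 1) (x2 :: 'f fls fls) = 1"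
    by (auto simp: deg_ge_def x2_def)
  have y: "deg_ge coef2 (1, 0) (y2 :: 'f fls fls) \<and> coef2 (1, 0) (y2 :: 'f fls fls) = 1"
    by (auto simp: deg_ge_def y2_def)
  have xy: "deg_ge coef2 (1, 1) (- (x2 * y2 :: 'f fls fls)) \<and> coef2 (1, 1) (- (x2 * y2 :: 'f fls fls)) = - 1"
    using deg_ge_mult[of "(0, 1)" x2 "(1, 0)" y2] x y by (auto simp: deg_ge_def)
  have "deg_ge coef2 (quat_weight i) (quat_square x2 y2 i :: 'f fls fls) \<and>
      coef2 (quat_weight i) (quat_square x2 y2 i :: 'f fls fls) \<noteq> 0" for i
    using one x y xy by (cases i) (auto simp: quat_weight_def quat_square_def)
  then show ?thesis
  proof unfold_locales
    fix i j and \<mu> \<nu> :: "int \<times> int"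
    assume eq: "\<mu> + \<mu> + quat_weight i = \<nu> + \<nu> + quat_weight j"
    obtain m m' n n' p p' q q' where "\<mu> = (m, m')" "\<nu> = (n, n')" "i = (p, p')" "j = (q, q')"
      by (metis surj_pair)
    with eq show "i = j"
      by (cases p; cases p'; cases q; cases q'; simp add: quat_weight_def; presburger)
  qed auto
qed

text \<open>The trace is the coefficient of 1. The product of two distinct basis elements is a
  scalar multiple of a basis element other than 1, whence orthogonality.\<close>

lemma orthogonal_basis_quaternion:
  fixes H :: "('f::field fls fls, 'h::ring_1) alg_inv"
  assumes H: "quaternion_algebra (scl H) x2 y2 u v" "is_involution H"
  shows "orthogonal_basis coef2 emb2 UNIV quat_weight (quat_square x2 y2) H (quat_basis u v)
    (quat_coord (scl H) u v) (False, False)"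
proof -
  let ?q = "quat_comb (scl H) u v" and ?xs = "quat_coord (scl H) u v" and ?e = "quat_basis u v"
  have s: "algebra_over (scl H)" and rel: "u * u = scl H x2 1" "v * v = scl H y2 1" "v * u = - (u * v)"
    and bij: "bij ?q"
    using H(1) by (simp_all add: quaternion_algebra_def)
  interpret vector_space "scl H" using s by (simp add: algebra_over_def)
  have xs: "?xs (?q (c0, c1, c2, c3)) =
      (\<lambda>(p, q). if p then if q then c3 else c1 else if q then c2 else c0)" for c0 c1 c2 c3
    using bij by (simp add: quat_coord_def bij_is_inj inv_f_f)
  have cases: "\<exists>c0 c1 c2 c3. x = ?q (c0, c1, c2, c3)" for x
    using bij by (metis bij_is_surj prod_cases4 surjD)
  have e: "?e i = ?q (of_bool (i = (False, False)), of_bool (i = (True, False)),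
      of_bool (i = (False, True)), of_bool (i = (True, True)))" for i
    by (cases i) (auto simp: quat_basis_def quat_comb_def)
  have UNIV4: "(UNIV :: (bool \<times> bool) set) = {(False, False), (True, False), (False, True), (True, True)}"
    by auto
  have q1: "?q (1, 0, 0, 0) = 1" by (simp add: quat_comb_def)
  show ?thesis
  proof (intro orthogonal_basis.intro orthogonal_basis_axioms.intro)
    fix h k and i j :: "bool \<times> bool" and c
    obtain c0 c1 c2 c3 where h: "h = ?q (c0, c1, c2, c3)" using cases by blast
    obtain d0 d1 d2 d3 where k: "k = ?q (d0, d1, d2, d3)" using cases by blast
    show "h = (\<Sum>i\<in>UNIV. scl H (?xs h i) (?e i))"
      by (simp add: h xs UNIV4 quat_basis_def, simp add: quat_comb_def algebra_simps)
    show "?xs (h + k) i = ?xs h i + ?xs k i"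
      by (cases i) (simp add: h k xs flip: quat_comb_add[OF s])
    show "?xs (scl H c h) i = c * ?xs h i"
      by (cases i) (simp add: h xs flip: quat_comb_scale[OF s])
    show "?xs (?e i * ?e j) (False, False) = (if i = j then quat_square x2 y2 i else 0)"
      unfolding e quat_comb_mult[OF s rel] xs
      by (cases i; cases j) (auto simp: quat_square_def)
    show "?e i * ?e i = scl H (quat_square x2 y2 i) 1"
      by (cases i) (auto simp: quat_basis_def quat_square_def rel quat_mult_table[OF s rel])
    show "?xs 1 i = (if i = (False, False) then 1 else 0)"
      using xs[of 1 0 0 0] by (cases i) (simp add: q1)
  qed (use s H(2) weighted_form_quat in \<open>auto simp: quat_basis_def quat_square_def quat_weight_def zero_prod_def\<close>)
qed

section \<open>Anisotropy and quaternion subalgebras over Laurent series fields\<close>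

text \<open>Both containments become the existence of quaternion generators. These pass to the
  tensor product as I \<otimes> 1 and J \<otimes> 1, and return through the residue map.\<close>

lemma tensor_anisotropic_and_contains_iff:
  fixes A :: "('f::field, 'a::ring_1) alg_inv" and B :: "('k::field, 'b::ring_1) alg_inv"
    and T :: "('k, 't::ring_1) alg_inv" and Q :: "('f, 'q::ring_1) alg_inv"
    and QK :: "('k, 'r::ring_1) alg_inv"
  assumes two: "(2::'f) \<noteq> 0" "(2::'k) \<noteq> 0" and \<iota>: "\<And>c. \<iota> c = 0 \<Longrightarrow> c = 0"
    and Q: "quaternion_algebra (scl Q) a b i j" "is_quat_conj Q i j"
    and A: "csa_with_involution A" "anisotropic A" and B: "is_involution B"
    and T: "is_tensor_product \<iota> A B T \<beta>" and QK: "is_tensor_product \<iota> Q field_alg_inv QK \<gamma>"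
    and rank_one: "\<And>S. finite S \<Longrightarrow> \<exists>h\<in>S. h \<noteq> 0 \<Longrightarrow> \<exists>l m. rank_one_on \<iota> B S l m"
      "\<And>S. finite S \<Longrightarrow> \<not> S \<subseteq> V \<Longrightarrow> \<exists>l m. rank_one_on \<iota> B S l m \<and> l 1 = 0"
    and residue: "residue_on \<iota> B V r"
  shows "anisotropic T \<and> (contains_alg_inv A Q \<longleftrightarrow> contains_alg_inv T QK)"
proof -
  have algebra_A: "algebra_over (scl A)" and invol_A: "is_involution A"
    using A(1) by (simp_all add: csa_with_involution_def central_simple_algebra_def)
  interpret anisotropic_tensor \<iota> A B T \<beta>
    by unfold_locales (use T algebra_A A in auto)
  have algebra_T: "algebra_over (scl T)" using T by (simp add: is_tensor_product_def)
  have invol_T: "is_involution T" using invol_A B by (rule is_involution_tensor)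
  have "invol B (x * y) = invol B y * invol B x" "invol B (invol B x) = x" for x y
    using B by (auto simp: is_involution_def)
  from this(1)[of "invol B 1" 1] this(2)[of 1] have "invol B 1 = 1" by simp
  note QK' = quaternion_algebra_extend[OF two(2) Q QK \<iota>] is_quat_conj_extend[OF two(2) Q QK \<iota>]
  have "(\<exists>I J. quaternion_pair A a b I J) \<longleftrightarrow> (\<exists>I J. quaternion_pair T (\<iota> a) (\<iota> b) I J)"
    using quaternion_pair_tensor \<open>invol B 1 = 1\<close> quaternion_pair_descends[OF rank_one(2) residue]
    by blast
  moreover have "contains_alg_inv A Q \<longleftrightarrow> (\<exists>I J. quaternion_pair A a b I J)"
    using quaternion_pair_if_contains[OF Q] contains_if_quaternion_pair[OF two(1) algebra_A invol_A Q]
    by blast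
  moreover have "contains_alg_inv T QK \<longleftrightarrow> (\<exists>I J. quaternion_pair T (\<iota> a) (\<iota> b) I J)"
    using quaternion_pair_if_contains[OF QK'] contains_if_quaternion_pair[OF two(2) algebra_T invol_T QK']
    by blast
  ultimately show ?thesis using anisotropic_tensor[OF rank_one(1)] by blast
qed

theorem theorem7p1:
  fixes A :: "('f::field, 'a::ring_1) alg_inv"
    and Q :: "('f, 'q::ring_1) alg_inv" and a b :: 'f and i j :: 'q
    and H :: "('f fls fls, 'h::ring_1) alg_inv" and u v :: 'h
    and A1 :: "('f fls, 'a1::ring_1) alg_inv" and \<beta>1 :: "'a \<Rightarrow> ('f fls, 2) sqmat \<Rightarrow> 'a1"
    and A2 :: "('f fls fls, 'a2::ring_1) alg_inv" and \<beta>2 :: "'a \<Rightarrow> 'h \<Rightarrow> 'a2"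
    and Q1 :: "('f fls, 'q1::ring_1) alg_inv" and \<gamma>1 :: "'q \<Rightarrow> 'f fls \<Rightarrow> 'q1"
    and Q2 :: "('f fls fls, 'q2::ring_1) alg_inv" and \<gamma>2 :: "'q \<Rightarrow> 'f fls fls \<Rightarrow> 'q2"
  assumes char_not_2: "(2::'f) \<noteq> 0"
    and Q: "quaternion_algebra (scl Q) a b i j" "is_quat_conj Q i j"
    and Q_not_split: "\<not> split_quaternion (scl Q)"
    and A: "csa_with_involution A"
    and H: "quaternion_algebra (scl H) x2 y2 u v" "is_involution H"
    and A1: "is_tensor_product emb1 A (Ad (pfister_form x1)) A1 \<beta>1"
    and A2: "is_tensor_product emb2 A H A2 \<beta>2"
    and Q1: "is_tensor_product emb1 Q field_alg_inv Q1 \<gamma>1"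
    and Q2: "is_tensor_product emb2 Q field_alg_inv Q2 \<gamma>2"
    and anisotropic_A: "anisotropic A"
  shows "anisotropic A1 \<and> anisotropic A2 \<and>
    (contains_alg_inv A Q \<longleftrightarrow> contains_alg_inv A1 Q1) \<and>
    (contains_alg_inv A Q \<longleftrightarrow> contains_alg_inv A2 Q2)"
proof -
  have two1: "(2::'f fls) \<noteq> 0"
    using char_not_2 by (metis fls_const_numeral fls_const_eq_0_iff)
  have two2: "(2::'f fls fls) \<noteq> 0"
    using two1 by (metis fls_const_numeral fls_const_eq_0_iff)
  have emb1: "emb1 = (fls_const :: 'f \<Rightarrow> _)"
    by (simp add: fun_eq_iff emb1_def)
  \<comment> \<open>Here \<open>V\<close> is \<open>Ad_order\<close>, and the slot \<open>_\<close>
    is the triviality of the kernel of \<open>fls_const\<close>.\<close>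
  have "anisotropic A1 \<and> (contains_alg_inv A Q \<longleftrightarrow> contains_alg_inv A1 Q1)"
    using char_not_2 two1 _ Q A anisotropic_A is_involution_Ad[OF two1 fls_X_nonzero]
      A1[unfolded emb1 x1_def] Q1[unfolded emb1]
      Ad_rank_one[OF char_not_2] residue_Ad[OF char_not_2]
    by (rule tensor_anisotropic_and_contains_iff) simp_all
  moreover interpret orthogonal_basis coef2 emb2 UNIV quat_weight "quat_square x2 y2" H
      "quat_basis u v" "quat_coord (scl H) u v" "(False, False)"
    using H by (rule orthogonal_basis_quaternion)
  have "anisotropic A2 \<and> (contains_alg_inv A Q \<longleftrightarrow> contains_alg_inv A2 Q2)"
    using char_not_2 two2 _ Q A anisotropic_A H(2) A2 Q2 order_rank_one residue_order
    by (rule tensor_anisotropic_and_contains_iff) (simp_all add: emb2_def)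
  ultimately show ?thesis by blast
qed

end
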